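(* Let $b\ge1100$ be an integer. Then $\mathscr{P}_b^*$ contains infinitely many cubefree palindromes, and, as $x\to\infty$, $$\sum_{\substack{n\in\mathscr{P}_b^*(x)\\ n\text{ is cubefree}}}1\sim\frac{\#\mathscr{P}_b^*(x)}{\zeta(3)}\prod_{p\mid b^3-b}\Big(1-\frac1{p^3}\Big)^{-1},$$ where the product is over primes $p$ dividing $b^3-b$.
   Context: $\mathscr{P}_b$ is the set of nonnegative integers that are palindromes in base $b$ (their base-$b$ digit expansion, without leading zeros, reads the same in both directions). $\mathscr{P}_b^*=\{n\in\mathscr{P}_b : (n,b^3-b)=1\}$, where $(\cdot,\cdot)$ is the greatest common divisor. For a set of integers $\mathscr{A}$ and a positive real $x$, $\mathscr{A}(x)=\mathscr{A}\cap[1,x]$. An integer is cubefree if it is not divisible by $q^3$ for any integer $q\ge2$. $\zeta$ is the Riemann zeta function. *)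

theory Defs
  imports
    "HOL-Analysis.Analysis"
    "HOL-Library.Landau_Symbols"
    "HOL-Computational_Algebra.Primes"
begin

text \<open>Base-\<open>b\<close> digits, least significant first and without leading zeros. In particular
  \<open>0\<close> has the empty expansion, so \<open>0\<close> is a palindrome. The guard \<open>b < 2\<close> is needed only
  for termination.\<close>

fun digits :: "nat \<Rightarrow> nat \<Rightarrow> nat list" where
  "digits b n = (if b < 2 \<or> n = 0 then [] else n mod b # digits b (n div b))"

declare digits.simps [simp del]

lemma horner_sum_digits:
  assumes "b \<ge> 2"
  shows "horner_sum (\<lambda>d. d) b (digits b n) = n"
  using assms
proof (induction b n rule: digits.induct)
  case (1 b n)
  then show ?case
    by (subst digits.simps) auto
qed

definition palindromes :: "nat \<Rightarrow> nat set" where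
  "palindromes b = {n. rev (digits b n) = digits b n}"

definition palindromes_star :: "nat \<Rightarrow> nat set" where
  "palindromes_star b = {n \<in> palindromes b. coprime n (b ^ 3 - b)}"

definition up_to :: "nat set \<Rightarrow> real \<Rightarrow> nat set" where
  "up_to A x = {n \<in> A. 1 \<le> real n \<and> real n \<le> x}"

definition cubefree :: "nat \<Rightarrow> bool" where
  "cubefree n \<longleftrightarrow> (\<forall>q\<ge>2. \<not> q ^ 3 dvd n)"

text \<open>The Riemann zeta function on the half-line \<open>s > 1\<close>, where it is given by its
  Dirichlet series. Outside that range the value is meaningless.\<close>

definition riemann_zeta :: "real \<Rightarrow> real" where
  "riemann_zeta s = (\<Sum>n. 1 / real (Suc n) powr s)"

end

theory Submission
  imports Defs "HOL-Number_Theory.Cong"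
begin

text \<open>A palindrome coprime to \<open>b ^ 3 - b\<close> has an odd number \<open>2 K + 1\<close> of digits, since \<open>b + 1\<close> divides
  every palindrome of even length. There are about \<open>b ^ K\<close> of them, i.e. about the square root of their size.

  Multiples of a large cube are rare: if \<open>q\<close> is coprime to \<open>b\<close>, prescribing the \<open>j\<close> leading digits of
  a palindrome fixes its residue modulo \<open>b ^ j\<close>, and for \<open>b ^ (2 j)\<close> about \<open>b ^ (2 K) / q\<close> this leaves
  boundedly many multiples of \<open>q\<close> for each choice of these digits. Hence there are
  \<open>O(b ^ K / sqrt q)\<close> of them, and the sum over \<open>q = d ^ 3\<close> converges.

  For a fixed \<open>q\<close> coprime to \<open>b ^ 3 - b\<close>, the exponential sum over palindromes factors over the digit
  pairs, and a positive proportion of the factors is nontrivial, so that palindromes are equidistributed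
  modulo \<open>q\<close>. A sieve by finitely many primes then yields the Euler product.\<close>

section \<open>Palindromes of odd length\<close>

text \<open>The modulus \<open>b^2 - 1\<close> shapes the argument. Modulo it \<open>b^2\<close> is
  1, so at a frequency with \<open>z^(b^2 - 1) = 1\<close> every digit pair may contribute a trivial
  factor (for instance \<open>z = -1\<close> with \<open>b\<close> odd), and no decay can be
  expected. Detecting coprimality to \<open>b^2 - 1\<close> by characters multiplies a
  \<open>q\<close>-th root of unity by a \<open>(b^2 - 1)\<close>-th one; decay is therefore proved
  for all \<open>z\<close> with \<open>z^(q (b^2 - 1)) = 1\<close> and
  \<open>z^(b^2 - 1) \<noteq> 1\<close>. This class is stable under \<open>z -> z^b\<close>, the
  passage to the inner digits.

  A cutoff \<open>n \<le> x\<close> destroys the product structure. Fixing leading digits repairs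
  this: whole blocks are shifted and scaled copies of shorter palindromes, and the same digits
  settle coprimality to \<open>b\<close>.

  For fixed \<open>q\<close> the error is only \<open>o(b^K)\<close>, with no uniformity in
  \<open>q\<close>. Hence a lower bound of order \<open>b^K\<close> for the palindromes coprime to
  \<open>b^3 - b\<close> is needed separately, and all cubes beyond a fixed cutoff are left to the
  bound on multiples, which is uniform in \<open>q\<close>.\<close>

locale palindrome_base =
  fixes b :: nat
  assumes b2: "b \<ge> 2"
begin

text \<open>The numbers whose expansion, padded with zeros to \<open>2 L + 1\<close> digits, is a palindrome.\<close>

primrec padded :: "nat \<Rightarrow> nat set" where
  "padded 0 = {..<b}"
| "padded (Suc L) = (\<lambda>(a, r). a * (1 + b ^ (2 * Suc L)) + b * r) ` ({..<b} \<times> padded L)"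

lemma finite_padded [simp]: "finite (padded L)"
  by (induction L) auto

lemma padded_less: "n \<in> padded L \<Longrightarrow> n < b ^ (2 * L + 1)"
proof (induction L arbitrary: n)
  case (Suc L)
  then obtain a r where ar: "a < b" "r \<in> padded L" and n: "n = a * (1 + b ^ (2 * Suc L)) + b * r"
    by auto
  from Suc.IH[OF ar(2)] have "Suc r \<le> b ^ (2 * L + 1)" by simp
  then have "b * Suc r \<le> b * b ^ (2 * L + 1)" by (rule mult_left_mono) simp
  also have "b * b ^ (2 * L + 1) = b ^ (2 * Suc L)" by simp
  finally have 1: "a + b * r < b ^ (2 * Suc L)" using ar(1) by simp
  have "Suc a * b ^ (2 * Suc L) \<le> b * b ^ (2 * Suc L)" by (rule mult_right_mono) (use ar in auto)
  with 1 have "n < b * b ^ (2 * Suc L)" unfolding n by (simp add: algebra_simps)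
  then show ?case by simp
qed simp

lemma padded_Suc_mod: "a < b \<Longrightarrow> (a * (1 + b ^ (2 * Suc L)) + b * r) mod b = a"
proof -
  assume "a < b"
  have "a * (1 + b ^ (2 * Suc L)) + b * r = a + b * (a * b ^ (2 * L + 1) + r)"
    by (simp add: algebra_simps)
  then show ?thesis using \<open>a < b\<close> by (metis mod_mult_self2 mod_less)
qed

lemma inj_padded: "inj_on (\<lambda>(a, r). a * (1 + b ^ (2 * Suc L)) + b * r) ({..<b} \<times> padded L)"
proof (rule inj_onI, safe)
  fix a r a' r'
  assume A: "a < b" "a' < b" and
    eq: "a * (1 + b ^ (2 * Suc L)) + b * r = a' * (1 + b ^ (2 * Suc L)) + b * r'"
  show "a = a'" using padded_Suc_mod[OF A(1), of L r] padded_Suc_mod[OF A(2), of L r'] eq by metis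
  with eq b2 show "r = r'" by simp
qed

lemma card_padded: "card (padded L) = b ^ Suc L"
  by (induction L) (simp_all add: card_image[OF inj_padded, simplified] card_cartesian_product)

text \<open>The outer digit and the inner palindrome vary independently and enter additively, so the
  sum splits. The inner sum is taken at \<open>z ^ b\<close>; iteration gives one geometric sum per
  digit pair, with frequencies \<open>z\<close>, \<open>z ^ b\<close>, \<open>z ^ (b ^ 2)\<close>
  and so on.\<close>

lemma sum_padded_Suc:
  "(\<Sum>n\<in>padded (Suc L). (z :: complex) ^ n) =
    (\<Sum>a<b. (z ^ (1 + b ^ (2 * Suc L))) ^ a) * (\<Sum>r\<in>padded L. (z ^ b) ^ r)"
proof -
  have "(\<Sum>n\<in>padded (Suc L). z ^ n) = (\<Sum>(a, r)\<in>{..<b} \<times> padded L. z ^ (a * (1 + b ^ (2 * Suc L)) + b * r))"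
    unfolding padded.simps(2) by (subst sum.reindex[OF inj_padded]) (simp add: case_prod_unfold o_def)
  also have "\<dots> = (\<Sum>(a, r)\<in>{..<b} \<times> padded L. (z ^ (1 + b ^ (2 * Suc L))) ^ a * (z ^ b) ^ r)"
    by (rule sum.cong) (auto simp: power_add power_mult[symmetric] mult.commute simp del: power_Suc mult_Suc mult_Suc_right)
  finally show ?thesis
    by (simp add: sum_product sum.cartesian_product)
qed

text \<open>By symmetry the \<open>J\<close> leading digits determine the \<open>J\<close> trailing
  ones, and \<open>c\<close> collects both ends. The middle is an arbitrary palindrome that may
  begin with zeros, which is the reason for padding. The division cuts off \<open>2 * L + 1\<close>
  middle and \<open>J\<close> trailing digits.\<close>

lemma padded_block:
  assumes "u < b ^ J"
  shows "\<exists>c. {n \<in> padded (J + L). n div b ^ (J + 2 * L + 1) = u} = (\<lambda>r. c + b ^ J * r) ` padded L"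
  using assms
proof (induction J arbitrary: u)
  case 0
  have "n div b ^ (2 * L + 1) = 0" if "n \<in> padded L" for n
    using padded_less[OF that] by simp
  then show ?case using 0 by (intro exI[of _ 0]) auto
next
  case (Suc J)
  define a0 where "a0 = u div b ^ J"
  have a0: "a0 < b" using Suc.prems unfolding a0_def by (simp add: less_mult_imp_div_less)
  define v where "v = u mod b ^ J"
  have v: "v < b ^ J" unfolding v_def using b2 by simp
  have u: "u = a0 * b ^ J + v" unfolding a0_def v_def by (rule div_mult_mod_eq[symmetric])
  from Suc.IH[OF v] obtain c where
    c: "{n \<in> padded (J + L). n div b ^ (J + 2 * L + 1) = v} = (\<lambda>r. c + b ^ J * r) ` padded L" by blast
  let ?M = "b ^ (2 * Suc (J + L))"
  have dv: "(a * (1 + ?M) + b * r) div b ^ (Suc J + 2 * L + 1) = a * b ^ J + r div b ^ (J + 2 * L + 1)"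
    if "a < b" for a r
  proof -
    have "a * (1 + ?M) + b * r = b * (a * b ^ (2 * (J + L) + 1) + r) + a"
      by (simp add: algebra_simps)
    then have 1: "(a * (1 + ?M) + b * r) div b = a * b ^ (2 * (J + L) + 1) + r"
      using that b2 by (simp only: div_mult_self4 div_less)
    have 2: "a * b ^ (2 * (J + L) + 1) = (a * b ^ J) * b ^ (J + 2 * L + 1)"
      by (simp add: power_add mult_2)
    have "b ^ (Suc J + 2 * L + 1) = b * b ^ (J + 2 * L + 1)" by simp
    then have "(a * (1 + ?M) + b * r) div b ^ (Suc J + 2 * L + 1)
        = ((a * b ^ J) * b ^ (J + 2 * L + 1) + r) div b ^ (J + 2 * L + 1)"
      by (simp only: div_mult2_eq 1 2)
    also have "\<dots> = a * b ^ J + r div b ^ (J + 2 * L + 1)"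
      using b2 by (intro div_mult_self3) simp
    finally show ?thesis .
  qed
  have lt: "r div b ^ (J + 2 * L + 1) < b ^ J" if "r \<in> padded (J + L)" for r
  proof -
    have "r < b ^ (2 * (J + L) + 1)" by (rule padded_less[OF that])
    also have "\<dots> = b ^ J * b ^ (J + 2 * L + 1)" by (simp add: power_add mult_2)
    finally show ?thesis by (rule less_mult_imp_div_less)
  qed
  have uniq: "a * b ^ J + w = u \<longleftrightarrow> a = a0 \<and> w = v" if "w < b ^ J" for a w
  proof
    assume eq: "a * b ^ J + w = u"
    have "a = a0" unfolding a0_def eq[symmetric] using that b2 by simp
    with eq u show "a = a0 \<and> w = v" by simp
  qed (use u in auto)
  have "{n \<in> padded (Suc J + L). n div b ^ (Suc J + 2 * L + 1) = u} =
     (\<lambda>r. a0 * (1 + ?M) + b * r) ` {n \<in> padded (J + L). n div b ^ (J + 2 * L + 1) = v}"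
    (is "?A = ?B")
  proof (intro subset_antisym subsetI)
    fix n assume n: "n \<in> ?A"
    then obtain a r where ar: "a < b" "r \<in> padded (J + L)" "n = a * (1 + ?M) + b * r"
      by (auto simp del: mult_Suc_right)
    from n ar dv[OF ar(1)] have "a * b ^ J + r div b ^ (J + 2 * L + 1) = u" by simp
    with uniq[OF lt[OF ar(2)]] ar show "n \<in> ?B" by auto
  next
    fix n assume "n \<in> ?B"
    then obtain r where r: "r \<in> padded (J + L)" "r div b ^ (J + 2 * L + 1) = v" "n = a0 * (1 + ?M) + b * r"
      by blast
    have "n \<in> padded (Suc J + L)" using r a0 by auto
    moreover have "n div b ^ (Suc J + 2 * L + 1) = u" using dv[OF a0] r u by simp
    ultimately show "n \<in> ?A" by simp
  qed
  also have "\<dots> = (\<lambda>r. (a0 * (1 + ?M) + b * c) + b ^ Suc J * r) ` padded L"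
    unfolding c image_image by (intro image_cong) (simp_all add: algebra_simps)
  finally show ?case by blast
qed

lemma padded_decomp:
  "padded (J + L) = (\<Union>u<b ^ J. {n \<in> padded (J + L). n div b ^ (J + 2 * L + 1) = u})"
proof -
  have "n div b ^ (J + 2 * L + 1) < b ^ J" if "n \<in> padded (J + L)" for n
  proof -
    have "n < b ^ (2 * (J + L) + 1)" by (rule padded_less[OF that])
    also have "\<dots> = b ^ J * b ^ (J + 2 * L + 1)" by (simp add: power_add mult_2)
    finally show ?thesis by (rule less_mult_imp_div_less)
  qed
  then show ?thesis by auto
qed

section \<open>Digit lists versus the recursive description of palindromes\<close>

definition horner :: "nat list \<Rightarrow> nat" where "horner = horner_sum (\<lambda>d. d) b"

lemma horner_simps [simp]: "horner [] = 0" "horner (x # xs) = x + b * horner xs"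
  by (simp_all add: horner_def)

lemma horner_append: "horner (xs @ ys) = horner xs + b ^ length xs * horner ys"
  by (induction xs) (auto simp: algebra_simps)

lemma rev_Cons_eqE:
  assumes "rev xs = xs" "length xs = Suc (Suc n)"
  obtains a ys where "xs = a # ys @ [a]" "rev ys = ys" "length ys = n"
proof -
  from assms(2) obtain a zs where 1: "xs = a # zs" "zs \<noteq> []" by (metis length_0_conv length_Suc_conv nat.simps(3))
  then obtain ys c where 2: "zs = ys @ [c]" by (metis rev_exhaust)
  have "c # rev ys @ [a] = a # ys @ [c]"
    using assms(1) unfolding 1(1) 2 by (simp only: rev.simps rev_append append.simps append_assoc)
  then have "c = a" "rev ys = ys" by (metis list.inject, metis list.inject append1_eq_conv)
  with 1 2 assms(2) show ?thesis by (intro that[of a ys]) auto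
qed

lemma odd_palindrome_padded:
  "rev xs = xs \<Longrightarrow> length xs = 2 * K + 1 \<Longrightarrow> set xs \<subseteq> {..<b} \<Longrightarrow> horner xs \<in> padded K"
proof (induction K arbitrary: xs)
  case 0
  then show ?case by (auto simp: length_Suc_conv)
next
  case (Suc K)
  then obtain a ys where ys: "xs = a # ys @ [a]" "rev ys = ys" "length ys = 2 * K + 1"
    using rev_Cons_eqE[OF Suc.prems(1), of "2 * K + 1"] by (metis add_Suc mult_Suc_right numeral_2_eq_2 add_2_eq_Suc)
  have "horner ys \<in> padded K" using Suc ys by auto
  moreover have "horner xs = a * (1 + b ^ (2 * Suc K)) + b * horner ys"
    using ys by (simp add: horner_append algebra_simps)
  moreover have "a < b" using Suc.prems ys by auto
  ultimately show ?case by auto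
qed

lemma padded_odd_palindrome:
  "n \<in> padded K \<Longrightarrow> \<exists>xs. rev xs = xs \<and> length xs = 2 * K + 1 \<and> set xs \<subseteq> {..<b} \<and> horner xs = n"
proof (induction K arbitrary: n)
  case 0
  then show ?case by (intro exI[of _ "[n]"]) auto
next
  case (Suc K)
  then obtain a r where ar: "a < b" "r \<in> padded K" "n = a * (1 + b ^ (2 * Suc K)) + b * r" by auto
  from Suc.IH[OF ar(2)] obtain ys where
    ys: "rev ys = ys" "length ys = 2 * K + 1" "set ys \<subseteq> {..<b}" "horner ys = r" by blast
  show ?case using ar ys
    by (intro exI[of _ "a # ys @ [a]"]) (auto simp: horner_append algebra_simps)
qed

text \<open>Modulo \<open>b + 1\<close> the base is -1, and mirrored positions in a word of even
  length have opposite parity, so their equal digits cancel.\<close>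

lemma even_palindrome_dvd:
  "rev xs = xs \<Longrightarrow> length xs = 2 * K \<Longrightarrow> (b + 1) dvd horner xs"
proof (induction K arbitrary: xs)
  case (Suc K)
  then obtain a ys where ys: "xs = a # ys @ [a]" "rev ys = ys" "length ys = 2 * K"
    using rev_Cons_eqE[OF Suc.prems(1), of "2 * K"] by (metis mult_Suc_right add_2_eq_Suc)
  have 1: "(b + 1) dvd 1 + b ^ (2 * K + 1)"
  proof (induction K)
    case (Suc K)
    \<comment> \<open>Subtraction-free form of \<open>b ^ (2 * K + 3) - b ^ (2 * K + 1) = (b + 1) *
      (b ^ (2 * K + 2) - b ^ (2 * K + 1))\<close>.\<close>
    have "1 + b ^ (2 * Suc K + 1) + (b + 1) * b ^ (2 * K + 1) = (1 + b ^ (2 * K + 1)) + (b + 1) * b ^ (2 * K + 2)"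
      by (simp add: algebra_simps)
    with Suc show ?case by (metis dvd_add_left_iff dvd_add dvd_triv_left)
  qed simp
  have "horner xs = a * (1 + b ^ (2 * K + 1)) + b * horner ys"
    using ys by (simp add: horner_append algebra_simps)
  with 1 Suc.IH[OF ys(2,3)] show ?case by (metis dvd_add dvd_mult)
qed simp

lemma digits_horner:
  "set xs \<subseteq> {..<b} \<Longrightarrow> xs = [] \<or> last xs \<noteq> 0 \<Longrightarrow> digits b (horner xs) = xs"
proof (induction xs)
  case Nil
  then show ?case by (simp add: digits.simps)
next
  case (Cons x xs)
  have IH: "digits b (horner xs) = xs" using Cons by (auto split: if_splits)
  have "horner (x # xs) \<noteq> 0"
  proof
    assume "horner (x # xs) = 0"
    then have x: "x = 0" "horner xs = 0" using b2 by auto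
    with IH have "xs = []" by (simp add: digits.simps)
    with x Cons.prems show False by simp
  qed
  then show ?case using b2 Cons.prems IH by (subst digits.simps) simp
qed

lemma set_digits: "set (digits b n) \<subseteq> {..<b}"
proof (induction n rule: less_induct)
  case (less n)
  show ?case
  proof (cases "n = 0")
    case False
    with b2 have "n div b < n" by simp
    from less[OF this] b2 False show ?thesis by (subst digits.simps) auto
  qed (simp add: digits.simps)
qed

lemma horner_digits: "horner (digits b n) = n"
  unfolding horner_def by (rule horner_sum_digits[OF b2])

lemma cube_diff_eq: "b ^ 3 - b = b * (b\<^sup>2 - 1)"
  by (simp add: power3_eq_cube power2_eq_square diff_mult_distrib2)

lemma Suc_dvd_cube_diff: "b + 1 dvd b ^ 3 - b"
proof -
  have "b\<^sup>2 - 1 = (b + 1) * (b - 1)"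
    by (simp add: power2_eq_square algebra_simps diff_mult_distrib2)
  then show ?thesis by (simp only: cube_diff_eq dvd_mult dvd_triv_left)
qed

text \<open>Coprimality to \<open>b\<close> makes the units digit nonzero, hence by symmetry the
  leading digit too, so the padded expansion is the true one. Coprimality to \<open>b + 1\<close>
  excludes even length.\<close>

lemma palindromes_star_eq:
  "palindromes_star b = {n. coprime n (b ^ 3 - b) \<and> (\<exists>K. n \<in> padded K)}"
proof -
  have "(\<exists>K. n \<in> padded K) \<longleftrightarrow> n \<in> palindromes b" if n: "coprime n (b ^ 3 - b)" for n
  proof
    have nb: "\<not> b dvd n" and nb1: "\<not> (b + 1) dvd n"
      using coprime_common_divisor_nat[OF n _ Suc_dvd_cube_diff] coprime_common_divisor_nat[OF n, of b] b2
      by (auto simp: cube_diff_eq)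
    {
      assume "\<exists>K. n \<in> padded K"
      then obtain K xs where xs: "rev xs = xs" "length xs = 2 * K + 1" "set xs \<subseteq> {..<b}" "horner xs = n"
        using padded_odd_palindrome by blast
      from xs(2) obtain y ys where y: "xs = y # ys" by (cases xs) auto
      have "y \<noteq> 0"
      proof
        assume "y = 0"
        with y xs(4) have "b dvd n" by auto
        with nb show False by simp
      qed
      with y xs(1) have "last xs \<noteq> 0" by (metis last_rev list.sel(1) list.distinct(1))
      from digits_horner[OF xs(3) disjI2[OF this]] xs show "n \<in> palindromes b"
        by (simp add: palindromes_def)
    }
    assume "n \<in> palindromes b"
    then have r: "rev (digits b n) = digits b n" by (simp add: palindromes_def)
    show "\<exists>K. n \<in> padded K"
    proof (cases "even (length (digits b n))")
      case True
      then obtain K where "length (digits b n) = 2 * K" by blast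
      from even_palindrome_dvd[OF r this] nb1 show ?thesis by (simp add: horner_digits)
    next
      case False
      then obtain K where "length (digits b n) = 2 * K + 1" by (elim oddE)
      from odd_palindrome_padded[OF r this set_digits] show ?thesis by (auto simp: horner_digits)
    qed
  qed
  then show ?thesis unfolding palindromes_star_def by blast
qed

end

section \<open>Exponential sums over palindromes\<close>

lemma power_gcd_eq_1:
  fixes z :: complex
  assumes "z ^ a = 1" "z ^ c = 1"
  shows "z ^ gcd a c = 1"
proof (cases "a = 0")
  case False
  then obtain x y where "a * x = c * y + gcd a c" using bezout_nat by blast
  then have "(z ^ a) ^ x = (z ^ c) ^ y * z ^ gcd a c" by (simp flip: power_mult power_add)
  then show ?thesis using assms by simp
qed (use assms in simp)

lemma norm_eq_1_of_power_eq_1: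
  fixes z :: complex
  assumes "z ^ n = 1" "n > 0"
  shows "norm z = 1"
  using assms power_eq_1_iff by blast

lemma norm_geometric_sum_le:
  fixes w :: complex
  assumes "norm w = 1"
  shows "norm (\<Sum>a<k. w ^ a) \<le> real k"
  using sum_norm_le[of "{..<k}" "\<lambda>a. w ^ a" "\<lambda>_. 1"] assms by (simp add: norm_power)

text \<open>The first two terms already lose: \<open>Re w < 1\<close> forces
  \<open>norm (1 + w) < 2\<close>. The remaining terms are bounded trivially.\<close>

lemma norm_geometric_sum_less:
  fixes w :: complex
  assumes w: "norm w = 1" "w \<noteq> 1" and k: "k \<ge> 2"
  shows "norm (\<Sum>a<k. w ^ a) < real k"
proof -
  have "Re w \<noteq> 1"
    using w by (metis cmod_eq_Re complex_is_Real_iff Im_eq_0 abs_one complex_eqI one_complex.sel)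
  moreover have "Re w \<le> 1" using w(1) complex_Re_le_cmod[of w] by simp
  ultimately have Re: "Re w < 1" by simp
  have "(norm (1 + w))\<^sup>2 = 1 + 2 * Re w + (norm w)\<^sup>2"
    unfolding cmod_power2 by (simp add: power2_eq_square algebra_simps)
  also have "\<dots> < 2\<^sup>2" using w(1) Re by simp
  finally have "norm (1 + w) < 2" by (rule power2_less_imp_less) simp
  moreover obtain j where j: "k = Suc (Suc j)" using k by (metis add_2_eq_Suc le_Suc_ex)
  have "(\<Sum>a<k. w ^ a) = (1 + w) + w\<^sup>2 * (\<Sum>a<j. w ^ a)"
    unfolding j by (simp add: sum.lessThan_Suc_shift sum_distrib_left power2_eq_square algebra_simps del: sum.lessThan_Suc)
  then have "norm (\<Sum>a<k. w ^ a) \<le> norm (1 + w) + norm (\<Sum>a<j. w ^ a)"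
    using norm_triangle_ineq[of "1 + w" "w\<^sup>2 * (\<Sum>a<j. w ^ a)"] w(1) by (simp add: norm_mult norm_power)
  with norm_geometric_sum_le[OF w(1), of j] calculation show ?thesis unfolding j by simp
qed

text \<open>Only finitely many roots of unity compete, so the strict inequalities have a uniform
  gap, given by the maximal ratio. Inserting 0 keeps the set nonempty when \<open>M = 1\<close> and
  makes the maximum nonnegative.\<close>

lemma geometric_sum_roots_of_unity_gap:
  assumes "M > 0" "k \<ge> 2"
  shows "\<exists>\<rho>. 0 \<le> \<rho> \<and> \<rho> < 1 \<and> (\<forall>w :: complex. w ^ M = 1 \<longrightarrow> w \<noteq> 1 \<longrightarrow> norm (\<Sum>a<k. w ^ a) \<le> \<rho> * real k)"
proof -
  define A where "A = insert 0 ((\<lambda>w :: complex. norm (\<Sum>a<k. w ^ a) / real k) ` {w. w ^ M = 1 \<and> w \<noteq> 1})"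
  have fin: "finite A"
    using finite_roots_unity[of M, where ?'a = complex] assms(1) unfolding A_def
    by (intro finite.insertI finite_imageI) (rule finite_subset[of _ "{w. w ^ M = 1}"], auto)
  have "\<forall>x\<in>A. x < 1"
    using norm_geometric_sum_less assms norm_eq_1_of_power_eq_1 unfolding A_def by auto
  then have "Max A < 1" using fin by (simp add: A_def)
  moreover have "0 \<le> Max A" using fin by (intro Max_ge) (auto simp: A_def)
  moreover have "norm (\<Sum>a<k. w ^ a) \<le> Max A * real k" if "w ^ M = 1" "w \<noteq> 1" for w :: complex
  proof -
    have "norm (\<Sum>a<k. w ^ a) / real k \<le> Max A" using fin that by (intro Max_ge) (auto simp: A_def)
    then show ?thesis using assms(2) by (simp add: field_simps)
  qed
  ultimately show ?thesis by blast
qed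

definition unity_root :: "nat \<Rightarrow> nat \<Rightarrow> complex" where
  "unity_root k j = exp (2 * of_real pi * \<i> * of_nat j / of_nat k)"

lemma unity_root_power: "unity_root k j ^ n = unity_root k (j * n)"
  unfolding unity_root_def by (simp flip: exp_of_nat_mult add: algebra_simps)

lemma unity_root_eq_1: "k \<ge> 1 \<Longrightarrow> unity_root k j = 1 \<longleftrightarrow> k dvd j"
  unfolding unity_root_def by (rule complex_root_unity_eq_1)

lemma sum_unity_root:
  assumes "k \<ge> 1"
  shows "(\<Sum>j<k. unity_root k j ^ n) = (if k dvd n then of_nat k else 0)"
proof -
  have eq: "(\<Sum>j<k. unity_root k j ^ n) = (\<Sum>j<k. unity_root k n ^ j)"
    by (simp add: unity_root_power mult.commute)
  show ?thesis
  proof (cases "k dvd n")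
    case True
    with assms have "unity_root k n = 1" by (simp add: unity_root_eq_1)
    with True eq show ?thesis by simp
  next
    case False
    with assms have "unity_root k n \<noteq> 1" by (simp add: unity_root_eq_1)
    moreover have "unity_root k n ^ k = 1" using assms by (simp add: unity_root_power unity_root_eq_1)
    ultimately show ?thesis using False eq by (simp add: geometric_sum)
  qed
qed

text \<open>Applied to the geometric sums of four consecutive digits: each has the trivial bound
  \<open>B\<close>, and one of them saves the factor \<open>\<rho>\<close>.\<close>

lemma mult4_le_of_factor:
  fixes g1 g2 g3 g4 \<rho> B :: real
  assumes "0 \<le> g1" "0 \<le> g2" "0 \<le> g3" "0 \<le> g4" "g1 \<le> B" "g2 \<le> B" "g3 \<le> B" "g4 \<le> B" "0 \<le> \<rho>"
    and "g1 \<le> \<rho> * B \<or> g2 \<le> \<rho> * B \<or> g3 \<le> \<rho> * B \<or> g4 \<le> \<rho> * B"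
  shows "g1 * g2 * g3 * g4 \<le> \<rho> * B ^ 4"
proof -
  have B: "0 \<le> B" using assms by linarith
  have *: "a * c * d * e \<le> \<rho> * B ^ 4"
    if "0 \<le> a" "0 \<le> c" "0 \<le> d" "0 \<le> e" "a \<le> \<rho> * B" "c \<le> B" "d \<le> B" "e \<le> B" for a c d e
  proof -
    have "a * c * d * e \<le> (\<rho> * B) * B * B * B"
      using that B assms(9) by (intro mult_mono mult_nonneg_nonneg) auto
    then show ?thesis by (simp add: power4_eq_xxxx mult.assoc)
  qed
  from assms(10) *[of g1 g2 g3 g4] *[of g2 g1 g3 g4] *[of g3 g1 g2 g4] *[of g4 g1 g2 g3] assms(1-8)
  show ?thesis by (auto simp: mult_ac)
qed

context palindrome_base
begin

lemma square_diff_pos: "b\<^sup>2 - 1 > 0"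
proof -
  have "2 * 2 \<le> b * b" using b2 by (intro mult_le_mono)
  then show ?thesis by (simp add: power2_eq_square)
qed

lemma coprime_b_square_diff: "coprime b (b\<^sup>2 - 1)"
proof -
  have "coprime (b\<^sup>2) (b\<^sup>2 - 1)" using b2 by (intro coprime_diff_one_right_nat) simp
  then show ?thesis by simp
qed

text \<open>The inner palindrome sees the frequency \<open>z ^ b\<close>, so the hypotheses of the
  decay estimate must survive this step. They do because \<open>q\<close> is coprime to
  \<open>b\<close>, which gives \<open>gcd (q * m) (b * m) = m\<close> for
  \<open>m = b^2 - 1\<close>.\<close>

lemma unity_root_step:
  fixes z :: complex
  assumes "z ^ (q * (b\<^sup>2 - 1)) = 1" "z ^ (b\<^sup>2 - 1) \<noteq> 1" "coprime q b"
  shows "(z ^ b) ^ (q * (b\<^sup>2 - 1)) = 1" "(z ^ b) ^ (b\<^sup>2 - 1) \<noteq> 1"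
proof -
  let ?m = "b\<^sup>2 - 1"
  show "(z ^ b) ^ (q * ?m) = 1" using assms(1) by (metis power_mult mult.commute power_one)
  show "(z ^ b) ^ ?m \<noteq> 1"
  proof
    assume "(z ^ b) ^ ?m = 1"
    then have "z ^ (b * ?m) = 1" by (simp add: power_mult)
    moreover have "gcd (q * ?m) (b * ?m) = ?m"
      using gcd_mult_distrib_nat[of ?m q b] coprime_imp_gcd_eq_1[OF assms(3)] by (simp add: mult.commute)
    ultimately show False using power_gcd_eq_1[OF assms(1), of "b * ?m"] assms(2) by simp
  qed
qed

text \<open>Among the factors contributed by four consecutive digits, one is a nontrivial root of unity:
  otherwise \<open>w = z ^ (b\<^sup>2 - 1)\<close> would satisfy \<open>w ^ (b\<^sup>2) = w\<close>, hence \<open>w = 1\<close>.\<close>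

lemma four_digits_nontrivial:
  fixes z :: complex
  assumes z: "z ^ (q * (b\<^sup>2 - 1)) = 1" "z ^ (b\<^sup>2 - 1) \<noteq> 1" "coprime q (b\<^sup>2 - 1)" "q > 0"
  shows "z ^ (1 + b ^ (2 * L + 8)) \<noteq> 1 \<or> z ^ (b * (1 + b ^ (2 * L + 6))) \<noteq> 1 \<or>
    z ^ (b\<^sup>2 * (1 + b ^ (2 * L + 4))) \<noteq> 1 \<or> z ^ (b ^ 3 * (1 + b ^ (2 * L + 2))) \<noteq> 1"
proof (rule ccontr)
  define m where "m = b\<^sup>2 - 1"
  have bm: "b\<^sup>2 = m + 1" using square_diff_pos by (simp add: m_def)
  define w where "w = z ^ m"
  have "norm z = 1" using norm_eq_1_of_power_eq_1[OF z(1)] z(4) square_diff_pos by simp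
  then have z0: "z \<noteq> 0" and w0: "w \<noteq> 0" by (auto simp: w_def)
  assume "\<not> ?thesis"
  then have e: "z ^ (1 + b ^ (2 * L + 8)) = 1" "z ^ (b * (1 + b ^ (2 * L + 6))) = 1"
     "z ^ (b\<^sup>2 * (1 + b ^ (2 * L + 4))) = 1" "z ^ (b ^ 3 * (1 + b ^ (2 * L + 2))) = 1" by auto
  \<comment> \<open>The exponents of the first and third digit differ by a multiple of
    \<open>m\<close>, so comparing them turns two conditions on \<open>z\<close> into one on
    \<open>w\<close>. The second and fourth digit are compared below in the same way.\<close>
  have "(1 + b ^ (2 * L + 8)) + m = b\<^sup>2 * (1 + b ^ (2 * L + 4)) + m * b ^ (2 * L + 6)"
  proof -
    have "b ^ (2 * L + 8) = b\<^sup>2 * b ^ (2 * L + 6)" "b\<^sup>2 * b ^ (2 * L + 4) = b ^ (2 * L + 6)"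
      by (simp_all add: numeral_eq_Suc)
    then show ?thesis by (simp add: bm algebra_simps)
  qed
  then have "z ^ (1 + b ^ (2 * L + 8)) * z ^ m = z ^ (b\<^sup>2 * (1 + b ^ (2 * L + 4))) * (z ^ m) ^ b ^ (2 * L + 6)"
    by (simp only: flip: power_add power_mult)
  then have w1: "w ^ b ^ (2 * L + 6) = w" using e by (simp add: w_def)
  have "b * (1 + b ^ (2 * L + 6)) + m * b = b ^ 3 * (1 + b ^ (2 * L + 2)) + m * b ^ (2 * L + 5)"
  proof -
    have "b * b ^ (2 * L + 6) = b\<^sup>2 * b ^ (2 * L + 5)" "b ^ 3 * b ^ (2 * L + 2) = b ^ (2 * L + 5)"
      "b ^ 3 = b\<^sup>2 * b"
      by (simp_all add: numeral_eq_Suc)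
    then show ?thesis by (simp add: bm algebra_simps)
  qed
  then have "z ^ (b * (1 + b ^ (2 * L + 6))) * (z ^ m) ^ b = z ^ (b ^ 3 * (1 + b ^ (2 * L + 2))) * (z ^ m) ^ b ^ (2 * L + 5)"
    by (simp only: flip: power_add power_mult)
  then have w2: "w ^ b ^ (2 * L + 5) = w ^ b" using e by (simp add: w_def)
  \<comment> \<open>The \<open>b\<close>-th power of the second relation meets the first one: the
    large exponents cancel and \<open>w ^ (b^2) = w\<close> remains.\<close>
  have "w ^ b ^ (2 * L + 6) = (w ^ b ^ (2 * L + 5)) ^ b"
  proof -
    have "b ^ (2 * L + 6) = b ^ (2 * L + 5) * b" by (simp add: numeral_eq_Suc)
    then show ?thesis by (simp only: power_mult)
  qed
  then have "w ^ b\<^sup>2 = w" using w1 w2 by (simp flip: power_mult add: power2_eq_square)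
  then have "w ^ m = 1" using w0 by (simp add: bm)
  then have "z ^ (m * m) = 1" by (simp add: w_def power_mult)
  \<comment> \<open>Coprimality of \<open>q\<close> to \<open>m\<close> brings the order of
    \<open>z\<close> down from a divisor of \<open>m * m\<close> to a divisor of \<open>m\<close>,
    contrary to the hypothesis on \<open>z\<close>.\<close>
  moreover have "gcd (q * m) (m * m) = m"
    using gcd_mult_distrib_nat[of m q m] coprime_imp_gcd_eq_1[OF z(3)] by (simp add: m_def mult.commute)
  ultimately show False using power_gcd_eq_1[OF z(1), of "m * m"] z(2) by (simp add: m_def)
qed

text \<open>Four layers are removed at a time. One of their geometric sums saves
  \<open>\<rho>\<close>, and the rest is the same sum at \<open>z ^ (b ^ 4)\<close>, which again
  satisfies the hypotheses. All digit factors are roots of unity of order dividing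
  \<open>q * (b^2 - 1)\<close>, so one \<open>\<rho>\<close> serves every \<open>L\<close> and
  \<open>z\<close>.\<close>

lemma sum_padded_decay:
  assumes q: "coprime q (b ^ 3 - b)" "q > 0"
  shows "\<exists>\<rho>. 0 \<le> \<rho> \<and> \<rho> < 1 \<and> (\<forall>L. \<forall>z :: complex. z ^ (q * (b\<^sup>2 - 1)) = 1 \<longrightarrow> z ^ (b\<^sup>2 - 1) \<noteq> 1 \<longrightarrow>
    norm (\<Sum>n\<in>padded L. z ^ n) \<le> real b ^ Suc L * \<rho> ^ (L div 4))"
proof -
  have qb: "coprime q b" and qm: "coprime q (b\<^sup>2 - 1)"
    using q(1) by (simp_all add: cube_diff_eq)
  let ?M = "q * (b\<^sup>2 - 1)"
  have M: "?M > 0" using q(2) square_diff_pos by simp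
  from geometric_sum_roots_of_unity_gap[OF M b2] obtain \<rho> where \<rho>: "0 \<le> \<rho>" "\<rho> < 1"
    and gap: "\<And>w :: complex. w ^ ?M = 1 \<Longrightarrow> w \<noteq> 1 \<Longrightarrow> norm (\<Sum>a<b. w ^ a) \<le> \<rho> * real b" by blast
  have "norm (\<Sum>n\<in>padded L. z ^ n) \<le> real b ^ Suc L * \<rho> ^ (L div 4)"
    if "z ^ ?M = 1" "z ^ (b\<^sup>2 - 1) \<noteq> 1" for L and z :: complex
    using that
  proof (induction L arbitrary: z rule: less_induct)
    case (less L)
    have nz: "norm z = 1" using norm_eq_1_of_power_eq_1[OF less.prems(1) M] .
    show ?case
    proof (cases "L < 4")
      case True
      have "norm (\<Sum>n\<in>padded L. z ^ n) \<le> real (card (padded L)) * 1"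
        by (intro sum_norm_bound) (simp add: norm_power nz)
      then show ?thesis using True by (simp add: card_padded)
    next
      case False
      define K where "K = L - 4"
      with False have K: "L = Suc (Suc (Suc (Suc K)))" by simp
      define z1 z2 z3 z4 where zs: "z1 = z ^ b" "z2 = z1 ^ b" "z3 = z2 ^ b" "z4 = z3 ^ b"
      have r1: "z1 ^ ?M = 1" "z1 ^ (b\<^sup>2 - 1) \<noteq> 1" unfolding zs by (rule unity_root_step[OF less.prems qb])+
      have r2: "z2 ^ ?M = 1" "z2 ^ (b\<^sup>2 - 1) \<noteq> 1" unfolding zs(2) by (rule unity_root_step[OF r1 qb])+
      have r3: "z3 ^ ?M = 1" "z3 ^ (b\<^sup>2 - 1) \<noteq> 1" unfolding zs(3) by (rule unity_root_step[OF r2 qb])+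
      have r4: "z4 ^ ?M = 1" "z4 ^ (b\<^sup>2 - 1) \<noteq> 1" unfolding zs(4) by (rule unity_root_step[OF r3 qb])+
      define w1 w2 w3 w4 where ws: "w1 = z ^ (1 + b ^ (2 * K + 8))" "w2 = z1 ^ (1 + b ^ (2 * K + 6))"
        "w3 = z2 ^ (1 + b ^ (2 * K + 4))" "w4 = z3 ^ (1 + b ^ (2 * K + 2))"
      have wM: "w1 ^ ?M = 1" "w2 ^ ?M = 1" "w3 ^ ?M = 1" "w4 ^ ?M = 1"
        unfolding ws using less.prems(1) r1(1) r2(1) r3(1) by (metis power_mult mult.commute power_one)+
      note nw = wM[THEN norm_eq_1_of_power_eq_1, OF M]
      let ?g = "\<lambda>w. norm (\<Sum>a<b. (w :: complex) ^ a)"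
      have nontriv: "w1 \<noteq> 1 \<or> w2 \<noteq> 1 \<or> w3 \<noteq> 1 \<or> w4 \<noteq> 1"
      proof -
        have "z ^ (b * (1 + b ^ (2 * K + 6))) = w2" "z ^ (b\<^sup>2 * (1 + b ^ (2 * K + 4))) = w3"
          "z ^ (b ^ 3 * (1 + b ^ (2 * K + 2))) = w4"
          unfolding ws zs by (simp_all only: power_mult power2_eq_square power3_eq_cube)
        with four_digits_nontrivial[OF less.prems qm q(2), of K] show ?thesis by (simp add: ws(1))
      qed
      have "?g w1 * ?g w2 * ?g w3 * ?g w4 \<le> \<rho> * real b ^ 4"
      proof (rule mult4_le_of_factor)
        show "?g w1 \<le> \<rho> * real b \<or> ?g w2 \<le> \<rho> * real b \<or> ?g w3 \<le> \<rho> * real b \<or> ?g w4 \<le> \<rho> * real b"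
          using nontriv gap wM by blast
      qed (use \<rho> nw norm_geometric_sum_le in auto)
      moreover have "norm (\<Sum>n\<in>padded K. z4 ^ n) \<le> real b ^ Suc K * \<rho> ^ (K div 4)"
        by (rule less.IH) (use r4 K in auto)
      ultimately have "(?g w1 * ?g w2 * ?g w3 * ?g w4) * norm (\<Sum>n\<in>padded K. z4 ^ n)
          \<le> (\<rho> * real b ^ 4) * (real b ^ Suc K * \<rho> ^ (K div 4))"
        by (rule mult_mono) (use \<rho> in auto)
      moreover have "norm (\<Sum>n\<in>padded L. z ^ n) = (?g w1 * ?g w2 * ?g w3 * ?g w4) * norm (\<Sum>n\<in>padded K. z4 ^ n)"
      proof -
        have "2 * Suc (Suc (Suc (Suc K))) = 2 * K + 8" "2 * Suc (Suc (Suc K)) = 2 * K + 6"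
          "2 * Suc (Suc K) = 2 * K + 4" "2 * Suc K = 2 * K + 2" by simp_all
        then show ?thesis unfolding K sum_padded_Suc norm_mult ws zs by (simp only: mult.assoc)
      qed
      moreover have "L div 4 = Suc (K div 4)" using K by simp
      moreover have "(\<rho> * real b ^ 4) * (real b ^ Suc K * \<rho> ^ (K div 4)) = real b ^ Suc L * \<rho> ^ Suc (K div 4)"
        unfolding K by (simp add: power4_eq_xxxx)
      ultimately show ?thesis by (simp only:)
    qed
  qed
  with \<rho> show ?thesis by blast
qed

end

section \<open>Equidistribution in blocks\<close>

text \<open>Coprimality to \<open>m\<close> depends only on the residue of \<open>n\<close>, so its
  indicator is expanded in additive characters modulo \<open>m\<close>. For each of at most
  \<open>m\<close> reduced residues this is an average of twisted sums, whence the factor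
  \<open>m\<close>.\<close>

lemma norm_sum_coprime_power_le:
  fixes z :: complex and D :: real
  assumes m: "m > 0" and S: "finite S"
    and D: "\<And>g. norm (\<Sum>n\<in>S. (z * unity_root m g) ^ n) \<le> D"
  shows "norm (\<Sum>n | n \<in> S \<and> coprime n m. z ^ n) \<le> real m * D"
proof -
  have D0: "0 \<le> D" using D[of 0] norm_ge_zero order_trans by blast
  \<comment> \<open>Orthogonality for the class of \<open>r\<close>; the exponent
    \<open>n + (m - r)\<close> replaces \<open>n - r\<close> to avoid truncated subtraction.\<close>
  have ind: "(\<Sum>g<m. unity_root m g ^ (n + (m - r))) = (if n mod m = r then of_nat m else 0)"
    if "r < m" for n r
  proof -
    have "m dvd n + (m - r) \<longleftrightarrow> n mod m = r"
    proof -
      define t where "t = n mod m"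
      have t: "t < m" using m by (simp add: t_def)
      have "m dvd n + (m - r) \<longleftrightarrow> m dvd t + (m - r)"
        by (simp add: t_def dvd_eq_mod_eq_0 mod_add_left_eq)
      also have "\<dots> \<longleftrightarrow> t = r"
      proof (cases t r rule: linorder_cases)
        case less
        then show ?thesis using \<open>r < m\<close> nat_dvd_not_less[of "t + (m - r)" m] by simp
      next
        case equal
        then show ?thesis using \<open>r < m\<close> by simp
      next
        case greater
        then have "t + (m - r) = m + (t - r)" using \<open>r < m\<close> by simp
        then have "m dvd t + (m - r) \<longleftrightarrow> m dvd t - r" by (simp only: dvd_add_triv_left_iff)
        then show ?thesis using greater t nat_dvd_not_less[of "t - r" m] by simp
      qed
      finally show ?thesis by (simp add: t_def)
    qed
    then show ?thesis using sum_unity_root[of m "n + (m - r)"] m by simp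
  qed
  let ?R = "{r. r < m \<and> coprime r m}"
  have "(\<Sum>n | n \<in> S \<and> coprime n m. z ^ n) = (\<Sum>n\<in>S. \<Sum>r\<in>?R. if n mod m = r then z ^ n else 0)"
  proof -
    have "(\<Sum>r\<in>?R. if n mod m = r then z ^ n else 0) = (if coprime n m then z ^ n else 0)" for n
      using m by (simp add: sum.delta coprime_mod_left_iff)
    then show ?thesis using S by (simp add: sum.If_cases Int_def)
  qed
  also have "\<dots> = (\<Sum>n\<in>S. \<Sum>r\<in>?R. z ^ n / of_nat m * (\<Sum>g<m. unity_root m g ^ (n + (m - r))))"
  proof (intro sum.cong refl)
    fix n r assume "r \<in> ?R"
    then have "r < m" by simp
    show "(if n mod m = r then z ^ n else 0) = z ^ n / of_nat m * (\<Sum>g<m. unity_root m g ^ (n + (m - r)))"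
      unfolding ind[OF \<open>r < m\<close>] using m by simp
  qed
  also have "\<dots> = (\<Sum>r\<in>?R. \<Sum>n\<in>S. z ^ n / of_nat m * (\<Sum>g<m. unity_root m g ^ (n + (m - r))))"
    by (rule sum.swap)
  also have "\<dots> = (\<Sum>r\<in>?R. \<Sum>g<m. unity_root m g ^ (m - r) / of_nat m * (\<Sum>n\<in>S. (z * unity_root m g) ^ n))"
  proof (rule sum.cong[OF refl])
    fix r
    have "(\<Sum>n\<in>S. z ^ n / of_nat m * (\<Sum>g<m. unity_root m g ^ (n + (m - r))))
      = (\<Sum>n\<in>S. \<Sum>g<m. unity_root m g ^ (m - r) / of_nat m * (z * unity_root m g) ^ n)"
      by (simp add: sum_distrib_left power_add power_mult_distrib mult_ac)
    also have "\<dots> = (\<Sum>g<m. \<Sum>n\<in>S. unity_root m g ^ (m - r) / of_nat m * (z * unity_root m g) ^ n)"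
      by (rule sum.swap)
    also have "\<dots> = (\<Sum>g<m. unity_root m g ^ (m - r) / of_nat m * (\<Sum>n\<in>S. (z * unity_root m g) ^ n))"
      by (simp only: sum_distrib_left)
    finally show "(\<Sum>n\<in>S. z ^ n / of_nat m * (\<Sum>g<m. unity_root m g ^ (n + (m - r))))
      = (\<Sum>g<m. unity_root m g ^ (m - r) / of_nat m * (\<Sum>n\<in>S. (z * unity_root m g) ^ n))" .
  qed
  finally have eq: "(\<Sum>n | n \<in> S \<and> coprime n m. z ^ n) =
    (\<Sum>r\<in>?R. \<Sum>g<m. unity_root m g ^ (m - r) / of_nat m * (\<Sum>n\<in>S. (z * unity_root m g) ^ n))" .
  have nu: "norm (unity_root m g) = 1" for g
    using norm_eq_1_of_power_eq_1[of "unity_root m g" m] m by (simp add: unity_root_power unity_root_eq_1)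
  have "norm (\<Sum>r\<in>?R. \<Sum>g<m. unity_root m g ^ (m - r) / of_nat m * (\<Sum>n\<in>S. (z * unity_root m g) ^ n))
     \<le> (\<Sum>r\<in>?R. \<Sum>g<m. 1 / real m * D)"
    using D nu by (intro sum_norm_le order.trans[OF norm_sum] sum_mono)
      (simp add: norm_mult norm_divide norm_power divide_right_mono)
  also have "\<dots> = real (card ?R) * D" using m by simp
  also have "\<dots> \<le> real m * D"
  proof (intro mult_right_mono D0)
    have "card ?R \<le> card {..<m}" by (intro card_mono) auto
    then show "real (card ?R) \<le> real m" by simp
  qed
  finally show ?thesis unfolding eq .
qed

text \<open>Only the residue class of 0 is measured, since the sieve asks only about divisibility.
  The absolute error is subadditive over disjoint unions, so blocks can be estimated one by
  one.\<close>

definition disc :: "nat \<Rightarrow> nat set \<Rightarrow> real" where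
  "disc q S = \<bar>real (card {n \<in> S. q dvd n}) - real (card S) / real q\<bar>"

lemma disc_le:
  assumes q: "q > 0" and S: "finite S" "0 \<le> D"
    and D: "\<And>h. 0 < h \<Longrightarrow> h < q \<Longrightarrow> norm (\<Sum>n\<in>S. unity_root q h ^ n) \<le> D"
  shows "disc q S \<le> D"
proof -
  have "of_real (real (card {n \<in> S. q dvd n})) = (\<Sum>n\<in>S. (\<Sum>h<q. unity_root q h ^ n) / of_nat q :: complex)"
    using S q by (simp add: sum_unity_root if_distrib[of "\<lambda>x. x / _"] sum.If_cases Int_def cong: if_cong)
  also have "\<dots> = (\<Sum>h<q. (\<Sum>n\<in>S. unity_root q h ^ n)) / of_nat q"
    by (subst sum.swap) (simp add: sum_divide_distrib)
  \<comment> \<open>The frequency \<open>h = 0\<close> contributes \<open>card S / q\<close>, the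
    expected count; the other frequencies form the error.\<close>
  also have "{..<q} = insert 0 {0<..<q}" using q by auto
  also have "(\<Sum>h\<in>insert 0 {0<..<q}. (\<Sum>n\<in>S. unity_root q h ^ n))
     = of_nat (card S) + (\<Sum>h\<in>{0<..<q}. (\<Sum>n\<in>S. unity_root q h ^ n))"
    by (simp add: unity_root_def)
  finally have eq: "of_real (real (card {n \<in> S. q dvd n}) - real (card S) / real q)
     = (\<Sum>h\<in>{0<..<q}. (\<Sum>n\<in>S. unity_root q h ^ n)) / (of_nat q :: complex)"
    by (simp add: add_divide_distrib)
  have "\<bar>real (card {n \<in> S. q dvd n}) - real (card S) / real q\<bar>
     = norm (\<Sum>h\<in>{0<..<q}. (\<Sum>n\<in>S. unity_root q h ^ n)) / real q"
    using arg_cong[OF eq, of norm] by (simp only: norm_of_real norm_divide norm_of_nat)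
  also have "\<dots> \<le> real q * D / real q"
  proof (intro divide_right_mono)
    have "norm (\<Sum>h\<in>{0<..<q}. (\<Sum>n\<in>S. unity_root q h ^ n)) \<le> real (card {0<..<q}) * D"
      using D by (intro sum_norm_bound) auto
    also have "\<dots> \<le> real q * D" using S q by (intro mult_right_mono) auto
    finally show "norm (\<Sum>h\<in>{0<..<q}. (\<Sum>n\<in>S. unity_root q h ^ n)) \<le> real q * D" .
  qed simp
  finally show ?thesis using q by (simp add: disc_def)
qed

lemma disc_nonneg: "0 \<le> disc q S" by (simp add: disc_def)

lemma disc_le_card:
  assumes "finite S" "q > 0"
  shows "disc q S \<le> real (card S)"
proof -
  have "card {n \<in> S. q dvd n} \<le> card S" using assms by (intro card_mono) auto
  moreover have "real (card S) / real q \<le> real (card S)" using assms by (simp add: divide_le_eq mult_le_cancel_left1)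
  moreover have "0 \<le> real (card S) / real q" by simp
  ultimately show ?thesis unfolding disc_def by linarith
qed

lemma disc_UN_le:
  assumes "finite I" "\<And>i. i \<in> I \<Longrightarrow> finite (S i)" "\<And>i j. i \<in> I \<Longrightarrow> j \<in> I \<Longrightarrow> i \<noteq> j \<Longrightarrow> S i \<inter> S j = {}"
  shows "disc q (\<Union>i\<in>I. S i) \<le> (\<Sum>i\<in>I. disc q (S i))"
proof -
  have "card (\<Union>i\<in>I. S i) = (\<Sum>i\<in>I. card (S i))"
    using assms by (intro card_UN_disjoint) auto
  moreover have "{n \<in> \<Union>i\<in>I. S i. q dvd n} = (\<Union>i\<in>I. {n \<in> S i. q dvd n})" by auto
  moreover have "card (\<Union>i\<in>I. {n \<in> S i. q dvd n}) = (\<Sum>i\<in>I. card {n \<in> S i. q dvd n})"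
  proof (intro card_UN_disjoint ballI impI)
    show "{n \<in> S i. q dvd n} \<inter> {n \<in> S j. q dvd n} = {}" if "i \<in> I" "j \<in> I" "i \<noteq> j" for i j
      using assms(3)[OF that] by auto
  qed (use assms in auto)
  ultimately have "real (card {n \<in> \<Union>i\<in>I. S i. q dvd n}) - real (card (\<Union>i\<in>I. S i)) / real q =
    (\<Sum>i\<in>I. real (card {n \<in> S i. q dvd n}) - real (card (S i)) / real q)"
    by (simp add: sum_subtractf sum_divide_distrib)
  then show ?thesis unfolding disc_def by (simp add: sum_abs)
qed

context palindrome_base
begin

text \<open>On a block, the sum at \<open>z\<close> is a unimodular constant times the palindrome
  sum at \<open>z ^ (b ^ J)\<close>. Here \<open>z\<close> is a product of roots of orders dividing
  \<open>q\<close> and \<open>m = b^2 - 1\<close>; raising it to the power \<open>m\<close> kills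
  the second and leaves the first nontrivial, as \<open>q\<close> does not divide
  \<open>h * m\<close>.\<close>

lemma block_disc:
  assumes q: "coprime q (b ^ 3 - b)" "q > 0"
  shows "\<exists>\<rho>. 0 \<le> \<rho> \<and> \<rho> < 1 \<and> (\<forall>c J L.
     disc q {n \<in> (\<lambda>r. c + b ^ J * r) ` padded L. coprime n (b\<^sup>2 - 1)}
       \<le> real (b\<^sup>2 - 1) * (real b ^ Suc L * \<rho> ^ (L div 4)))"
proof -
  let ?m = "b\<^sup>2 - 1"
  have qb: "coprime q b" and qm: "coprime q ?m"
    using q(1) by (simp_all add: cube_diff_eq)
  note m0 = square_diff_pos
  from sum_padded_decay[OF q] obtain \<rho> where \<rho>: "0 \<le> \<rho>" "\<rho> < 1"
    and decay: "\<And>L (z :: complex). z ^ (q * ?m) = 1 \<Longrightarrow> z ^ ?m \<noteq> 1 \<Longrightarrow>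
      norm (\<Sum>n\<in>padded L. z ^ n) \<le> real b ^ Suc L * \<rho> ^ (L div 4)" by blast
  have "disc q {n \<in> (\<lambda>r. c + b ^ J * r) ` padded L. coprime n ?m} \<le> real ?m * (real b ^ Suc L * \<rho> ^ (L div 4))"
    for c J L
  proof (rule disc_le[OF q(2)])
    let ?B = "(\<lambda>r. c + b ^ J * r) ` padded L"
    let ?D = "real b ^ Suc L * \<rho> ^ (L div 4)"
    show "finite {n \<in> ?B. coprime n ?m}" by simp
    show "0 \<le> real ?m * ?D" using \<rho> by simp
    fix h assume h: "0 < h" "h < q"
    show "norm (\<Sum>n\<in>{n \<in> ?B. coprime n ?m}. unity_root q h ^ n) \<le> real ?m * ?D"
    proof (rule norm_sum_coprime_power_le[OF m0])
      fix g
      define z where "z = unity_root q h * unity_root ?m g"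
      have z: "z ^ (q * ?m) = 1"
      proof -
        have "unity_root q (h * (q * ?m)) = 1" by (subst unity_root_eq_1) (use q(2) in auto)
        moreover have "unity_root ?m (g * (q * ?m)) = 1" by (subst unity_root_eq_1) (use m0 in auto)
        ultimately show ?thesis unfolding z_def power_mult_distrib unity_root_power by simp
      qed
      have "\<not> q dvd h * ?m"
        using h qm by (simp add: coprime_dvd_mult_left_iff nat_dvd_not_less)
      then have zm: "z ^ ?m \<noteq> 1"
      proof -
        assume "\<not> q dvd h * ?m"
        then have "unity_root q (h * ?m) \<noteq> 1" by (subst unity_root_eq_1) (use q(2) in auto)
        moreover have "unity_root ?m (g * ?m) = 1" by (subst unity_root_eq_1) (use m0 in auto)
        ultimately show ?thesis unfolding z_def power_mult_distrib unity_root_power by simp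
      qed
      have step: "(z ^ b ^ J) ^ (q * ?m) = 1 \<and> (z ^ b ^ J) ^ ?m \<noteq> 1"
      proof (induction J)
        case (Suc J)
        from unity_root_step[OF _ _ qb, of "z ^ b ^ J"] Suc
        have "((z ^ b ^ J) ^ b) ^ (q * ?m) = 1 \<and> ((z ^ b ^ J) ^ b) ^ ?m \<noteq> 1" by blast
        moreover have "(z ^ b ^ J) ^ b = z ^ b ^ Suc J" by (simp flip: power_mult add: mult.commute)
        ultimately show ?case by simp
      qed (use z zm in simp)
      have "norm z = 1" using norm_eq_1_of_power_eq_1[OF z] q(2) m0 by simp
      have "inj_on (\<lambda>r. c + b ^ J * r) (padded L)" using b2 by (auto intro: inj_onI)
      then have "(\<Sum>n\<in>?B. z ^ n) = z ^ c * (\<Sum>r\<in>padded L. (z ^ b ^ J) ^ r)"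
        by (simp add: sum.reindex power_add power_mult sum_distrib_left)
      then have "norm (\<Sum>n\<in>?B. z ^ n) = norm (\<Sum>r\<in>padded L. (z ^ b ^ J) ^ r)"
        using \<open>norm z = 1\<close> by (simp add: norm_mult norm_power)
      with decay[of "z ^ b ^ J" L] step show "norm (\<Sum>n\<in>?B. z ^ n) \<le> ?D" by simp
    qed simp
  qed
  with \<rho> show ?thesis by blast
qed

text \<open>Grouping by the \<open>J\<close> leading digits, the condition \<open>n \<le> X\<close> truncates at most one block.\<close>

lemma padded_disc:
  assumes q: "coprime q (b ^ 3 - b)" "q > 0"
  shows "\<exists>\<rho>. 0 \<le> \<rho> \<and> \<rho> < 1 \<and> (\<forall>J L X. J > 0 \<longrightarrow>
     disc q {n \<in> padded (J + L). coprime n (b ^ 3 - b) \<and> n \<le> X}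
       \<le> real b ^ Suc (J + L) * (real (b\<^sup>2 - 1) * \<rho> ^ (L div 4) + 1 / real b ^ J))"
proof -
  from block_disc[OF q] obtain \<rho> where \<rho>: "0 \<le> \<rho>" "\<rho> < 1" and
    bd: "\<And>c J L. disc q {n \<in> (\<lambda>r. c + b ^ J * r) ` padded L. coprime n (b\<^sup>2 - 1)}
       \<le> real (b\<^sup>2 - 1) * (real b ^ Suc L * \<rho> ^ (L div 4))" by blast
  have "disc q {n \<in> padded (J + L). coprime n (b ^ 3 - b) \<and> n \<le> X}
       \<le> real b ^ Suc (J + L) * (real (b\<^sup>2 - 1) * \<rho> ^ (L div 4) + 1 / real b ^ J)" if J: "J > 0" for J L X
  proof -
    let ?P = "b ^ (J + 2 * L + 1)"
    define D where "D = real (b\<^sup>2 - 1) * (real b ^ Suc L * \<rho> ^ (L div 4))"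
    have D0: "0 \<le> D" unfolding D_def using \<rho> by simp
    define S where "S = (\<lambda>u. {n \<in> padded (J + L). n div ?P = u \<and> coprime n (b ^ 3 - b) \<and> n \<le> X})"
    have S_le: "disc q (S u) \<le> (if u = X div ?P then real b ^ Suc L else D)" if u: "u < b ^ J" for u
    proof -
      from padded_block[OF u] obtain c where
        c: "{n \<in> padded (J + L). n div ?P = u} = (\<lambda>r. c + b ^ J * r) ` padded L" by blast
      \<comment> \<open>The block containing \<open>X\<close> gets only the trivial bound; blocks
        above it are empty, and those below it are complete.\<close>
      consider "u = X div ?P" | "u > X div ?P" | "u < X div ?P" by linarith
      then show ?thesis
      proof cases
        case 1
        have "S u \<subseteq> (\<lambda>r. c + b ^ J * r) ` padded L" unfolding c[symmetric] S_def by auto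
        then have "card (S u) \<le> card ((\<lambda>r. c + b ^ J * r) ` padded L)" by (intro card_mono) auto
        also have "\<dots> \<le> b ^ Suc L" using card_image_le[of "padded L"] by (simp add: card_padded)
        finally have "card (S u) \<le> b ^ Suc L" .
        then have "real (card (S u)) \<le> real b ^ Suc L" by (metis of_nat_le_iff of_nat_power)
        moreover have "finite (S u)" unfolding S_def by simp
        ultimately show ?thesis using disc_le_card[of "S u" q] q(2) 1 by simp
      next
        case 2
        have "S u = {}" unfolding S_def using 2 div_le_mono[of _ X ?P] by (fastforce simp: not_le)
        then show ?thesis using 2 D0 by (simp add: disc_def)
      next
        case 3
        have le: "n \<le> X" if "n div ?P = u" for n
          using 3 that div_le_mono[of X n ?P] by (metis linorder_not_le nat_le_linear)
        \<comment> \<open>Since \<open>J > 0\<close>, the units digit is constant on a block, so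
          coprimality to \<open>b\<close> keeps the whole block or discards it.\<close>
        have cb: "coprime n b \<longleftrightarrow> coprime c b" if "n \<in> (\<lambda>r. c + b ^ J * r) ` padded L" for n
        proof -
          from that obtain r where "n = c + b ^ J * r" by blast
          with J have "n mod b = c mod b" by (cases J) (auto simp: mult.assoc)
          then show ?thesis using b2 by (metis coprime_mod_left_iff not_numeral_le_zero)
        qed
        have "S u = {n \<in> {n \<in> padded (J + L). n div ?P = u}. coprime n b \<and> coprime n (b\<^sup>2 - 1)}"
          unfolding S_def using le by (auto simp: cube_diff_eq)
        also have "\<dots> = (if coprime c b then {n \<in> (\<lambda>r. c + b ^ J * r) ` padded L. coprime n (b\<^sup>2 - 1)} else {})"
          unfolding c using cb by auto
        finally show ?thesis using bd[of c J L] 3 D0 by (auto simp: D_def disc_def)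
      qed
    qed
    have "{n \<in> padded (J + L). coprime n (b ^ 3 - b) \<and> n \<le> X} = (\<Union>u<b ^ J. S u)"
      unfolding S_def using padded_decomp[of J L] by auto
    also have "disc q \<dots> \<le> (\<Sum>u<b ^ J. disc q (S u))"
      by (rule disc_UN_le) (auto simp: S_def)
    also have "\<dots> \<le> (\<Sum>u<b ^ J. D + (if u = X div ?P then real b ^ Suc L else 0))"
      using S_le D0 by (intro sum_mono) (fastforce split: if_splits)
    also have "\<dots> \<le> real b ^ J * D + real b ^ Suc L"
      by (simp add: sum.distrib sum.delta)
    also have "\<dots> = real b ^ Suc (J + L) * (real (b\<^sup>2 - 1) * \<rho> ^ (L div 4) + 1 / real b ^ J)"
      unfolding D_def using b2 by (simp add: field_simps power_add)
    finally show ?thesis .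
  qed
  with \<rho> show ?thesis by blast
qed

end

section \<open>Counting palindromes in residue classes\<close>

lemma diff_less_of_div_eq:
  fixes x y m :: nat
  assumes "m > 0" "x div m = y div m"
  shows "y - x < m"
  using dividend_less_times_div[OF assms(1), of y] times_div_less_eq_dividend[of m x] assms by simp

context palindrome_base
begin

text \<open>Two layers are added, the inner one with digit 0. The shift multiplies the old number by
  \<open>b^2\<close>, which is 1 modulo \<open>b^2 - 1\<close>, and the outer digit \<open>e\<close>
  counts twice because both of its place values are 1 as well.\<close>

lemma padded_residues_step:
  assumes n: "n \<in> padded W" "v mod (b\<^sup>2 - 1) = n mod (b\<^sup>2 - 1)" and e: "e < 2" and "even W"
  shows "\<exists>n'\<in>padded (Suc (Suc W)). n' mod (b\<^sup>2 - 1) = (v + 2 * e) mod (b\<^sup>2 - 1)"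
proof -
  from \<open>even W\<close> obtain w where w: "W = 2 * w" by blast
  have bm: "[b\<^sup>2 = 1] (mod b\<^sup>2 - 1)"
  proof -
    have "b\<^sup>2 = (b\<^sup>2 - 1) + 1" using square_diff_pos by simp
    then show ?thesis by (metis cong_add_rcancel_0_nat cong_refl cong_def mod_self mod_0)
  qed
  have n1: "b * n \<in> padded (Suc W)" using n b2 by (auto intro!: rev_image_eqI[of "(0, n)"])
  then have n2: "e * (1 + b ^ (2 * Suc (Suc W))) + b * (b * n) \<in> padded (Suc (Suc W))"
    using e b2 by (auto simp only: padded.simps(2)[of "Suc W"] intro!: rev_image_eqI[of "(e, b * n)"])
  have "2 * Suc (Suc W) = 2 * (2 * w + 2)" by (simp add: w)
  then have "e * (1 + b ^ (2 * Suc (Suc W))) + b * (b * n) = e * (1 + (b\<^sup>2) ^ (2 * w + 2)) + b\<^sup>2 * n"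
    by (simp only: power_mult power2_eq_square mult.assoc)
  also have "[e * (1 + (b\<^sup>2) ^ (2 * w + 2)) + b\<^sup>2 * n = e * (1 + 1 ^ (2 * w + 2)) + 1 * v] (mod b\<^sup>2 - 1)"
    using n(2) by (intro cong_add cong_mult cong_pow bm cong_refl) (simp add: cong_def)
  finally have cg: "[e * (1 + b ^ (2 * Suc (Suc W))) + b * (b * n) = e * (1 + 1 ^ (2 * w + 2)) + 1 * v] (mod b\<^sup>2 - 1)" .
  have "[e * (1 + b ^ (2 * Suc (Suc W))) + b * (b * n) = v + 2 * e] (mod b\<^sup>2 - 1)"
  proof -
    have "e * (1 + 1 ^ (2 * w + 2)) + 1 * v = v + 2 * e" by simp
    then show ?thesis using cg by (simp only:)
  qed
  with n2 show ?thesis by (auto simp only: cong_def)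
qed

text \<open>The central digit 0 or 1 fixes the parity of \<open>v\<close>, and each pair of layers
  extends the reachable range by 2. With \<open>W = b^2 - 1\<close> this covers a complete residue
  system.\<close>

lemma padded_residues_aux: "v \<le> 2 * W + 1 \<Longrightarrow> \<exists>n\<in>padded (2 * W). n mod (b\<^sup>2 - 1) = v mod (b\<^sup>2 - 1)"
proof (induction W arbitrary: v)
  case 0
  then show ?case using b2 by (intro bexI[of _ v]) auto
next
  case (Suc W)
  define e where "e = (if v \<le> 2 * W + 1 then 0 else 1 :: nat)"
  from Suc have "v - 2 * e \<le> 2 * W + 1" by (auto simp: e_def)
  from Suc.IH[OF this] obtain n where n: "n \<in> padded (2 * W)" "n mod (b\<^sup>2 - 1) = (v - 2 * e) mod (b\<^sup>2 - 1)" by blast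
  have "(v - 2 * e) + 2 * e = v" by (auto simp: e_def)
  with padded_residues_step[OF n(1) n(2)[symmetric], of e] show ?case by (simp add: e_def)
qed

lemma padded_residues: "\<exists>n\<in>padded (2 * (b\<^sup>2 - 1)). n mod (b\<^sup>2 - 1) = t mod (b\<^sup>2 - 1)"
proof -
  have "t mod (b\<^sup>2 - 1) < b\<^sup>2 - 1" using square_diff_pos by simp
  then have "t mod (b\<^sup>2 - 1) \<le> 2 * (b\<^sup>2 - 1) + 1" by linarith
  from padded_residues_aux[OF this] show ?thesis by simp
qed

lemma inverse_mod_square_diff: "\<exists>y. (x + b ^ k * y) mod (b\<^sup>2 - 1) = t mod (b\<^sup>2 - 1)"
proof -
  let ?m = "b\<^sup>2 - 1"
  have "coprime (b ^ k) ?m" using coprime_b_square_diff by simp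
  then obtain i where i: "[b ^ k * i = 1] (mod ?m)" using cong_solve_coprime_nat[of "b ^ k" ?m] by auto
  \<comment> \<open>In the naturals \<open>t + x * (?m - 1)\<close> plays the role of
    \<open>t - x\<close> modulo \<open>?m\<close>, and \<open>i\<close> inverts
    \<open>b ^ k\<close>.\<close>
  define y where "y = i * (t + x * (?m - 1))"
  have "[x + b ^ k * y = x + 1 * (t + x * (?m - 1))] (mod ?m)"
    unfolding y_def using i by (intro cong_add cong_refl) (metis cong_scalar_right mult.assoc)
  also have "x + 1 * (t + x * (?m - 1)) = t + x * ?m"
  proof -
    obtain m' where "?m = Suc m'" using square_diff_pos by (metis gr0_implies_Suc)
    then show ?thesis by simp
  qed
  also have "[\<dots> = t] (mod ?m)" by (simp add: cong_def)
  finally show ?thesis unfolding cong_def by blast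
qed

text \<open>Each choice of the \<open>J\<close> leading digits leaves a middle long enough to
  realise every residue, so every block contributes an element.\<close>

lemma card_padded_residue_ge:
  "b ^ J \<le> card {n \<in> padded (J + 2 * (b\<^sup>2 - 1)). n mod (b\<^sup>2 - 1) = t mod (b\<^sup>2 - 1)}"
proof -
  let ?m = "b\<^sup>2 - 1"
  let ?P = "b ^ (J + 2 * (2 * ?m) + 1)"
  let ?S = "{n \<in> padded (J + 2 * ?m). n mod ?m = t mod ?m}"
  have "{..<b ^ J} \<subseteq> (\<lambda>n. n div ?P) ` ?S"
  proof
    fix u assume "u \<in> {..<b ^ J}"
    then obtain c where
      c: "{n \<in> padded (J + 2 * ?m). n div ?P = u} = (\<lambda>r. c + b ^ J * r) ` padded (2 * ?m)"
      using padded_block[of u J "2 * ?m"] by auto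
    obtain y where y: "(c + b ^ J * y) mod ?m = t mod ?m" using inverse_mod_square_diff by blast
    obtain r where r: "r \<in> padded (2 * ?m)" "r mod ?m = y mod ?m" using padded_residues by blast
    have "[c + b ^ J * r = c + b ^ J * y] (mod ?m)"
      using r(2) by (intro cong_add cong_mult cong_refl) (simp add: cong_def)
    with y have "(c + b ^ J * r) mod ?m = t mod ?m" by (simp add: cong_def)
    moreover have "c + b ^ J * r \<in> {n \<in> padded (J + 2 * ?m). n div ?P = u}" unfolding c using r(1) by blast
    ultimately show "u \<in> (\<lambda>n. n div ?P) ` ?S" by (intro image_eqI[of _ _ "c + b ^ J * r"]) auto
  qed
  then have "card {..<b ^ J} \<le> card ((\<lambda>n. n div ?P) ` ?S)" by (intro card_mono) auto
  also have "\<dots> \<le> card ?S" by (intro card_image_le) simp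
  finally show ?thesis by simp
qed

text \<open>Outer digit 1 gives coprimality to \<open>b\<close>, and the residue of the inner part
  is chosen so that the whole number is 1 modulo \<open>b^2 - 1\<close>. This shows that the
  coprimality conditions cost only a constant factor.\<close>

lemma card_padded_coprime_ge:
  "b ^ J \<le> card {n \<in> padded (Suc (J + 2 * (b\<^sup>2 - 1))). coprime n (b ^ 3 - b)}"
proof -
  let ?m = "b\<^sup>2 - 1"
  let ?K = "J + 2 * ?m"
  let ?f = "\<lambda>r. 1 * (1 + b ^ (2 * Suc ?K)) + b * r"
  obtain t where t: "((1 + b ^ (2 * Suc ?K)) + b ^ 1 * t) mod ?m = 1 mod ?m"
    using inverse_mod_square_diff by blast
  let ?S = "{n \<in> padded ?K. n mod ?m = t mod ?m}"
  have "b ^ J \<le> card ?S" by (rule card_padded_residue_ge)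
  also have "\<dots> = card (?f ` ?S)" using b2 by (intro card_image[symmetric] inj_onI) simp
  also have "\<dots> \<le> card {n \<in> padded (Suc ?K). coprime n (b ^ 3 - b)}"
  proof (intro card_mono subsetI)
    fix n assume "n \<in> ?f ` ?S"
    then obtain r where r: "r \<in> padded ?K" "r mod ?m = t mod ?m" and n: "n = ?f r" by blast
    have "n \<in> padded (Suc ?K)" using r(1) b2 n by (auto simp only: padded.simps intro!: rev_image_eqI[of "(1, r)"])
    moreover have "coprime n b"
    proof -
      have "n mod b = 1" unfolding n using b2 by (intro padded_Suc_mod) simp
      then show ?thesis using b2 by (metis coprime_mod_left_iff coprime_1_left not_numeral_le_zero)
    qed
    moreover have "coprime n ?m"
    proof -
      have "[n = 1 * (1 + b ^ (2 * Suc ?K)) + b * t] (mod ?m)"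
        unfolding n using r(2) by (intro cong_add cong_mult cong_refl) (simp add: cong_def)
      with t have "[1 = n] (mod ?m)" by (simp add: cong_def)
      then show ?thesis by (rule cong_imp_coprime) simp
    qed
    ultimately show "n \<in> {n \<in> padded (Suc ?K). coprime n (b ^ 3 - b)}"
      by (simp add: cube_diff_eq)
  qed simp
  finally show ?thesis .
qed

text \<open>Choose \<open>j\<close> with \<open>b ^ (2 j)\<close> about \<open>b ^ (2 K) / q\<close>. The \<open>j\<close> leading digits of a palindrome determine its
  \<open>j\<close> trailing ones, so a multiple of \<open>q\<close> with prescribed leading digits lies in a single class
  modulo \<open>q b ^ j\<close>, which is comparable to the length of the corresponding interval.\<close>

lemma card_padded_multiples_le:
  assumes q: "coprime q b" "q > 0"
  shows "real (card {n \<in> padded K. n > 0 \<and> q dvd n}) \<le> real b ^ 2 * sqrt (real b ^ (2 * K + 1) / real q)"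
proof (cases "q < b ^ (2 * K + 1)")
  case False
  have "n = 0" if "n \<in> padded K" "q dvd n" for n
    using padded_less[OF that(1)] False that(2) by (meson dvd_imp_le less_le_trans not_less gr0I)
  then have "{n \<in> padded K. n > 0 \<and> q dvd n} = {}" by auto
  then show ?thesis by (simp only: card.empty) simp
next
  case True
  let ?Q = "\<lambda>j. b ^ (2 * j) * q \<le> b ^ (2 * K + 1)"
  have bnd: "j \<le> K" if "?Q j" for j
  proof (rule ccontr)
    assume "\<not> j \<le> K"
    then have "b ^ (2 * K + 1) < b ^ (2 * j)" using b2 by (intro power_strict_increasing) auto
    also have "\<dots> \<le> b ^ (2 * j) * q" using q(2) by simp
    finally show False using that by simp
  qed
  define j where "j = Greatest ?Q"
  have Q0: "?Q 0" using True by simp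
  have Qj: "?Q j" unfolding j_def by (rule GreatestI_nat[where P = ?Q and k = 0, OF Q0]) (use bnd in auto)
  have nQ: "\<not> ?Q (Suc j)"
    using Greatest_le_nat[of ?Q "Suc j" K] bnd unfolding j_def[symmetric] by auto
  define L where "L = K - j"
  have K: "K = j + L" using bnd[OF Qj] by (simp add: L_def)
  let ?P = "b ^ (j + 2 * L + 1)" and ?M = "q * b ^ j"
  let ?S = "{n \<in> padded K. n > 0 \<and> q dvd n}"
  \<comment> \<open>Maximality of \<open>j\<close>: an interval of length \<open>?P\<close> is
    shorter than \<open>b^2\<close> periods of length \<open>?M\<close>, which is the source of the
    factor \<open>b ^ 2\<close> in the bound.\<close>
  have P: "?P < b\<^sup>2 * ?M"
  proof -
    have "b ^ (2 * K + 1) = b ^ j * ?P" unfolding K by (simp add: power_add mult_2)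
    moreover have "b ^ (2 * Suc j) * q = b ^ j * (b\<^sup>2 * ?M)" by (simp add: power_add mult_2 power2_eq_square)
    ultimately have "b ^ j * ?P < b ^ j * (b\<^sup>2 * ?M)" using nQ by (simp only: not_le)
    then show ?thesis using b2 by (simp only: nat_mult_less_cancel_disj)
  qed
  \<comment> \<open>A multiple is encoded by its leading digits and by the period of length
    \<open>?M\<close> in which its remainder falls. Two multiples with the same code differ by a
    multiple of \<open>?M\<close> smaller than \<open>?M\<close>.\<close>
  have "inj_on (\<lambda>n. (n div ?P, (n mod ?P) div ?M)) ?S"
  proof (rule inj_onI)
    have *: "x = y" if xy: "x \<le> y" "x \<in> ?S" "y \<in> ?S" and eq: "x div ?P = y div ?P" "(x mod ?P) div ?M = (y mod ?P) div ?M" for x y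
    proof -
      let ?u = "x div ?P"
      have "?u < b ^ j"
      proof -
        have "x < b ^ (2 * K + 1)" using xy padded_less by blast
        also have "\<dots> = b ^ j * ?P" unfolding K by (simp add: power_add mult_2)
        finally show ?thesis by (rule less_mult_imp_div_less)
      qed
      then obtain c where c: "{n \<in> padded (j + L). n div ?P = ?u} = (\<lambda>r. c + b ^ j * r) ` padded L"
        using padded_block by blast
      have "x \<in> (\<lambda>r. c + b ^ j * r) ` padded L" "y \<in> (\<lambda>r. c + b ^ j * r) ` padded L"
        unfolding c[symmetric] using xy eq K by auto
      then obtain r s where "x = c + b ^ j * r" "y = c + b ^ j * s" by blast
      then have "b ^ j dvd y - x" by (simp flip: diff_mult_distrib2)
      moreover have "q dvd y - x" using xy by (simp add: dvd_diff_nat)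
      moreover have "coprime q (b ^ j)" using q(1) by simp
      ultimately have dvd: "?M dvd y - x" by (simp add: divides_mult)
      have "x = ?u * ?P + x mod ?P" by (rule div_mult_mod_eq[symmetric])
      moreover have "y = ?u * ?P + y mod ?P" unfolding eq(1) by (rule div_mult_mod_eq[symmetric])
      ultimately have "y - x = y mod ?P - x mod ?P" by linarith
      moreover have "y mod ?P - x mod ?P < ?M"
        by (rule diff_less_of_div_eq) (use q b2 eq(2) in simp_all)
      ultimately have "y - x < ?M" by simp
      with dvd have "y - x = 0" by (meson nat_dvd_not_less gr0I)
      with xy show "x = y" by simp
    qed
    fix x y assume "x \<in> ?S" "y \<in> ?S" "(x div ?P, (x mod ?P) div ?M) = (y div ?P, (y mod ?P) div ?M)"
    then show "x = y" using *[of x y] *[of y x] by (cases "x \<le> y") auto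
  qed
  moreover have "(\<lambda>n. (n div ?P, (n mod ?P) div ?M)) ` ?S \<subseteq> {..<b ^ j} \<times> {..<b\<^sup>2}"
  proof safe
    fix x assume "x \<in> padded K"
    have "x < b ^ (2 * K + 1)" using \<open>x \<in> padded K\<close> padded_less by blast
    also have "\<dots> = b ^ j * ?P" unfolding K by (simp add: power_add mult_2)
    finally show "x div ?P < b ^ j" by (rule less_mult_imp_div_less)
    have "x mod ?P < ?P" using b2 by simp
    also have "\<dots> < b\<^sup>2 * ?M" by (rule P)
    finally show "x mod ?P div ?M < b\<^sup>2" by (rule less_mult_imp_div_less)
  qed
  ultimately have "card ?S \<le> card ({..<b ^ j} \<times> {..<b\<^sup>2})" by (intro card_inj_on_le) auto
  then have "card ?S \<le> b ^ j * b\<^sup>2" by simp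
  then have 1: "real (card ?S) \<le> real b ^ j * real b ^ 2" by (metis of_nat_le_iff of_nat_mult of_nat_power)
  have "real (b ^ (2 * j) * q) \<le> real (b ^ (2 * K + 1))" using Qj by (simp only: of_nat_le_iff)
  then have "(real b ^ j)\<^sup>2 \<le> real b ^ (2 * K + 1) / real q"
    using q(2) by (simp add: field_simps power_mult[symmetric] mult.commute)
  then have "real b ^ j \<le> sqrt (real b ^ (2 * K + 1) / real q)" by (rule real_le_rsqrt)
  then have "real b ^ j * real b ^ 2 \<le> sqrt (real b ^ (2 * K + 1) / real q) * real b ^ 2" by (rule mult_right_mono) simp
  with 1 show ?thesis by (simp add: mult.commute)
qed

end

section \<open>The Euler product\<close>

lemma summable_inverse_cubes: "summable (\<lambda>n. 1 / real (Suc n) ^ 3)"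
  using inverse_power_summable[of 3, where ?'a = real]
  by (subst summable_Suc_iff) (simp add: divide_inverse)

lemma riemann_zeta_3: "riemann_zeta 3 = (\<Sum>n. 1 / real (Suc n) ^ 3)"
proof -
  have "real (Suc n) powr 3 = real (Suc n) ^ 3" for n by (rule powr_numeral) simp
  then show ?thesis unfolding riemann_zeta_def by simp
qed

text \<open>To sieve by one more prime \<open>p\<close>, the terms divisible by \<open>p\<close> are
  subtracted. They form the reindexed series over \<open>p * Suc k\<close>, which is
  \<open>1 / p ^ 3\<close> times the old one because \<open>p\<close> is coprime to the primes
  already in \<open>S\<close>.\<close>

lemma sums_coprime_inverse_cubes:
  assumes "finite S" "\<And>p. p \<in> S \<Longrightarrow> prime p"
  shows "(\<lambda>n. if \<forall>p\<in>S. \<not> p dvd Suc n then 1 / real (Suc n) ^ 3 else 0) sums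
    (riemann_zeta 3 * (\<Prod>p\<in>S. 1 - 1 / real p ^ 3))"
  using assms
proof (induction S rule: finite_induct)
  case empty
  show ?case using summable_sums[OF summable_inverse_cubes] by (simp add: riemann_zeta_3)
next
  case (insert p S)
  let ?f = "\<lambda>S n. if \<forall>p\<in>S. \<not> p dvd Suc n then 1 / real (Suc n) ^ 3 else 0"
  let ?Z = "riemann_zeta 3 * (\<Prod>p\<in>S. 1 - 1 / real p ^ 3)"
  have p: "prime p" and Sp: "\<And>r. r \<in> S \<Longrightarrow> prime r" using insert.prems by auto
  have IH: "?f S sums ?Z" using insert.IH Sp by blast
  define g where "g = (\<lambda>k. p * Suc k - 1)"
  have Sg: "Suc (g k) = p * Suc k" for k
    using prime_gt_0_nat[OF p] by (cases p) (simp_all add: g_def)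
  have "strict_mono g"
  proof (rule strict_monoI_Suc)
    fix k show "g k < g (Suc k)" using prime_gt_0_nat[OF p] Sg[of k] Sg[of "Suc k"] by simp
  qed
  let ?h = "\<lambda>n. if p dvd Suc n then ?f S n else 0"
  have "?h sums (?Z * (1 / real p ^ 3)) \<longleftrightarrow> (\<lambda>k. ?h (g k)) sums (?Z * (1 / real p ^ 3))"
  proof (rule sums_mono_reindex[symmetric, OF \<open>strict_mono g\<close>])
    fix n assume n: "n \<notin> range g"
    have "\<not> p dvd Suc n"
    proof
      assume "p dvd Suc n"
      then obtain j where j: "Suc n = p * j" by blast
      then obtain k where "j = Suc k" by (cases j) auto
      with j Sg[of k] have "n = g k" by simp
      with n show False by blast
    qed
    then show "?h n = 0" by simp
  qed
  moreover have "?h (g k) = ?f S k * (1 / real p ^ 3)" for k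
  proof -
    have "r dvd p * Suc k \<longleftrightarrow> r dvd Suc k" if "r \<in> S" for r
    proof -
      have "coprime r p" using Sp[OF that] p that insert.hyps(2) primes_coprime by blast
      then show ?thesis by (simp add: coprime_dvd_mult_right_iff del: mult_Suc_right)
    qed
    then show ?thesis unfolding Sg by (auto simp: power_mult_distrib simp del: of_nat_Suc mult_Suc_right)
  qed
  ultimately have "?h sums (?Z * (1 / real p ^ 3))" using sums_mult2[OF IH] by (simp only:)
  from sums_diff[OF IH this]
  have "(\<lambda>n. ?f S n - ?h n) sums (?Z - ?Z * (1 / real p ^ 3))" .
  moreover have "?f S n - ?h n = ?f (insert p S) n" for n by simp
  moreover have "?Z - ?Z * (1 / real p ^ 3) = riemann_zeta 3 * (\<Prod>p\<in>insert p S. 1 - 1 / real p ^ 3)"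
    using insert.hyps by (simp add: algebra_simps)
  ultimately show ?case by simp
qed

text \<open>Sieving by all primes up to \<open>y\<close> removes the integers from 2 to
  \<open>y\<close>. The term 1 remains, and everything else is dominated by the tail of the series
  for \<open>riemann_zeta 3\<close>.\<close>

lemma euler_product_3:
  "(\<lambda>y. riemann_zeta 3 * (\<Prod>p | prime p \<and> p \<le> y. 1 - 1 / real p ^ 3)) \<longlonglongrightarrow> 1"
proof (rule LIMSEQ_I)
  fix r :: real assume "0 < r"
  let ?g = "\<lambda>n. 1 / real (Suc n) ^ 3"
  from LIMSEQ_D[OF suminf_exist_split2[OF summable_inverse_cubes] \<open>0 < r\<close>]
  obtain M where M: "\<And>y. y \<ge> M \<Longrightarrow> norm (\<Sum>k. ?g (k + y)) < r" by auto
  have "norm (riemann_zeta 3 * (\<Prod>p | prime p \<and> p \<le> y. 1 - 1 / real p ^ 3) - 1) < r" if y: "y \<ge> Suc M" for y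
  proof -
    let ?S = "{p. prime p \<and> p \<le> y}"
    let ?f = "\<lambda>n. if \<forall>p\<in>?S. \<not> p dvd Suc n then ?g n else 0"
    have f: "?f sums (riemann_zeta 3 * (\<Prod>p\<in>?S. 1 - 1 / real p ^ 3))"
      by (rule sums_coprime_inverse_cubes) auto
    have f0: "?f 0 = 1" by auto
    have fz: "?f n = 0" if "0 < n" "n < y" for n
    proof -
      from that obtain p where "prime p" "p dvd Suc n" using prime_factor_nat[of "Suc n"] by auto
      moreover have "p \<le> y" using that \<open>p dvd Suc n\<close> by (meson Suc_leI dvd_imp_le le_trans zero_less_Suc)
      ultimately show ?thesis by auto
    qed
    obtain y' where y': "y = Suc y'" using y by (cases y) auto
    have "(\<Sum>n<y. ?f n) = ?f 0 + (\<Sum>n<y'. ?f (Suc n))"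
      unfolding y' by (rule sum.lessThan_Suc_shift)
    also have "(\<Sum>n<y'. ?f (Suc n)) = 0" using fz y' by (intro sum.neutral ballI) simp
    finally have "(\<Sum>n<y. ?f n) = 1" using f0 by simp
    with suminf_split_initial_segment[OF sums_summable[OF f], of y] sums_unique[OF f]
    have eq: "riemann_zeta 3 * (\<Prod>p\<in>?S. 1 - 1 / real p ^ 3) - 1 = (\<Sum>k. ?f (k + y))" by simp
    have sg: "summable (\<lambda>k. ?g (k + y))" using summable_inverse_cubes by (rule summable_ignore_initial_segment)
    have sf: "summable (\<lambda>k. ?f (k + y))" using sums_summable[OF f] by (rule summable_ignore_initial_segment)
    have "0 \<le> (\<Sum>k. ?f (k + y))" by (intro suminf_nonneg sf) simp
    moreover have "(\<Sum>k. ?f (k + y)) \<le> (\<Sum>k. ?g (k + y))" by (intro suminf_le sf sg) simp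
    moreover have "norm (\<Sum>k. ?g (k + y)) < r" by (rule M) (use y in simp)
    ultimately show ?thesis unfolding eq by simp
  qed
  then show "\<exists>no. \<forall>y\<ge>no. norm (riemann_zeta 3 * (\<Prod>p | prime p \<and> p \<le> y. 1 - 1 / real p ^ 3) - 1) < r" by blast
qed

lemma riemann_zeta_3_pos: "riemann_zeta 3 > 0"
  unfolding riemann_zeta_3 by (intro suminf_pos summable_inverse_cubes) simp

lemma one_minus_inverse_cube_pos: "prime p \<Longrightarrow> 0 < 1 - 1 / real p ^ 3"
proof -
  assume "prime p"
  then have "1 < real p ^ 3" using prime_gt_1_nat[of p] by (intro one_less_power) auto
  moreover from this have "0 < real p ^ 3" by linarith
  ultimately show ?thesis by simp
qed

lemma euler_product_3_coprime:
  assumes "B > 0"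
  shows "(\<lambda>y. \<Prod>p | prime p \<and> p \<le> y \<and> \<not> p dvd B. 1 - 1 / real p ^ 3) \<longlonglongrightarrow>
    1 / riemann_zeta 3 * (\<Prod>p | prime p \<and> p dvd B. inverse (1 - 1 / real p ^ 3))"
proof -
  let ?P = "\<Prod>p | prime p \<and> p dvd B. 1 - 1 / real p ^ 3"
  have "?P > 0" using one_minus_inverse_cube_pos by (intro prod_pos) auto
  have lim: "(\<lambda>y. 1 / (riemann_zeta 3 * ?P) * (riemann_zeta 3 * (\<Prod>p | prime p \<and> p \<le> y. 1 - 1 / real p ^ 3)))
     \<longlonglongrightarrow> 1 / (riemann_zeta 3 * ?P) * 1"
    by (intro tendsto_mult tendsto_const euler_product_3)
  have val: "1 / (riemann_zeta 3 * ?P) * 1 = 1 / riemann_zeta 3 * (\<Prod>p | prime p \<and> p dvd B. inverse (1 - 1 / real p ^ 3))"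
    using prod_inversef[of "\<lambda>p. 1 - 1 / real p ^ 3" "{p. prime p \<and> p dvd B}"] by (simp add: o_def divide_inverse)
  have ev: "\<forall>\<^sub>F y in sequentially.
     1 / (riemann_zeta 3 * ?P) * (riemann_zeta 3 * (\<Prod>p | prime p \<and> p \<le> y. 1 - 1 / real p ^ 3))
       = (\<Prod>p | prime p \<and> p \<le> y \<and> \<not> p dvd B. 1 - 1 / real p ^ 3)"
    \<comment> \<open>For \<open>y \<ge> B\<close> all prime divisors of \<open>B\<close> are among
      the primes up to \<open>y\<close>, so the product splits exactly.\<close>
    using eventually_ge_at_top[of B]
  proof eventually_elim
    case (elim y)
    have "{p. prime p \<and> p \<le> y} = {p. prime p \<and> p dvd B} \<union> {p. prime p \<and> p \<le> y \<and> \<not> p dvd B}"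
      using elim assms by (auto dest: dvd_imp_le)
    moreover have "finite {p. prime p \<and> p dvd B}" using assms by (simp add: finite_divisors_nat)
    ultimately have "(\<Prod>p | prime p \<and> p \<le> y. 1 - 1 / real p ^ 3)
       = ?P * (\<Prod>p | prime p \<and> p \<le> y \<and> \<not> p dvd B. 1 - 1 / real p ^ 3)"
      by (simp only:) (rule prod.union_disjoint, auto)
    then show ?case using \<open>?P > 0\<close> riemann_zeta_3_pos by simp
  qed
  from Lim_transform_eventually[OF lim ev] show ?thesis unfolding val .
qed

section \<open>Densities\<close>

lemma sum_power_le:
  fixes c :: real
  assumes "c \<ge> 2"
  shows "(\<Sum>K\<le>N. c ^ K) \<le> 2 * c ^ N"
proof (induction N)
  case (Suc N)
  have "2 * c ^ N \<le> c * c ^ N" using assms by (intro mult_right_mono) auto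
  with Suc show ?case by simp
qed simp

text \<open>The weights concentrate near \<open>K = N\<close>: a fixed initial segment is negligible
  against \<open>c ^ N\<close>, and the rest has total weight at most \<open>2 * c ^ N\<close>,
  hence the choice \<open>r / 4\<close>. It serves to add up the errors over all palindrome
  lengths.\<close>

lemma geometric_weighted_sum_tendsto_0:
  fixes e :: "nat \<Rightarrow> real" and c :: real
  assumes e: "e \<longlonglongrightarrow> 0" and c: "c \<ge> 2"
  shows "(\<lambda>N. (\<Sum>K\<le>N. c ^ K * e K) / c ^ N) \<longlonglongrightarrow> 0"
proof (rule LIMSEQ_I)
  fix r :: real assume r: "0 < r"
  from LIMSEQ_D[OF e, of "r / 4"] r obtain M where M: "\<And>K. K \<ge> M \<Longrightarrow> \<bar>e K\<bar> < r / 4" by auto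
  define A where "A = \<bar>\<Sum>K<M. c ^ K * e K\<bar>"
  have "(\<lambda>N. A / c ^ N) \<longlonglongrightarrow> 0"
    using c by (intro LIMSEQ_divide_realpow_zero) simp
  from LIMSEQ_D[OF this, of "r / 2"] r obtain M' where M': "\<And>N. N \<ge> M' \<Longrightarrow> \<bar>A / c ^ N\<bar> < r / 2" by auto
  have "norm ((\<Sum>K\<le>N. c ^ K * e K) / c ^ N - 0) < r" if N: "N \<ge> max M M'" for N
  proof -
    have "{..N} = {..<M} \<union> {M..N}" using N by auto
    then have "(\<Sum>K\<le>N. c ^ K * e K) = (\<Sum>K<M. c ^ K * e K) + (\<Sum>K=M..N. c ^ K * e K)"
      by (simp add: sum.union_disjoint ivl_disj_int)
    moreover have "\<bar>\<Sum>K=M..N. c ^ K * e K\<bar> \<le> (\<Sum>K=M..N. c ^ K * (r / 4))"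
      using M c by (intro order.trans[OF sum_abs] sum_mono) (auto simp: abs_mult intro!: mult_left_mono less_imp_le)
    moreover have "(\<Sum>K=M..N. c ^ K * (r / 4)) \<le> (\<Sum>K\<le>N. c ^ K * (r / 4))"
      using c r by (intro sum_mono2) auto
    moreover have "(\<Sum>K\<le>N. c ^ K * (r / 4)) \<le> (2 * c ^ N) * (r / 4)"
      unfolding sum_distrib_right[symmetric] using sum_power_le[OF c] r by (intro mult_right_mono) auto
    ultimately have "\<bar>\<Sum>K\<le>N. c ^ K * e K\<bar> \<le> A + c ^ N * (r / 2)" unfolding A_def by linarith
    then have "\<bar>\<Sum>K\<le>N. c ^ K * e K\<bar> / c ^ N \<le> (A + c ^ N * (r / 2)) / c ^ N"
      using c by (intro divide_right_mono) auto
    also have "\<dots> = A / c ^ N + r / 2" using c by (simp add: add_divide_distrib)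
    also have "\<dots> < r" using M'[of N] N by linarith
    finally show ?thesis using c by (simp add: abs_divide)
  qed
  then show "\<exists>no. \<forall>N\<ge>no. norm ((\<Sum>K\<le>N. c ^ K * e K) / c ^ N - 0) < r" by blast
qed

lemma cubefree_iff_prime: "cubefree n \<longleftrightarrow> (\<forall>p. prime p \<longrightarrow> \<not> p ^ 3 dvd n)"
proof
  assume "cubefree n"
  then show "\<forall>p. prime p \<longrightarrow> \<not> p ^ 3 dvd n" by (auto simp: cubefree_def prime_ge_2_nat)
next
  assume *: "\<forall>p. prime p \<longrightarrow> \<not> p ^ 3 dvd n"
  show "cubefree n" unfolding cubefree_def
  proof (intro allI impI notI)
    fix q assume "2 \<le> q" "q ^ 3 dvd n"
    then obtain p where "prime p" "p dvd q" using prime_factor_nat[of q] by auto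
    then have "p ^ 3 dvd n" using \<open>q ^ 3 dvd n\<close> by (meson dvd_power_same dvd_trans)
    with * \<open>prime p\<close> show False by blast
  qed
qed

lemma sum_tail_le_suminf:
  fixes f :: "nat \<Rightarrow> real"
  assumes "summable f" "\<And>n. 0 \<le> f n"
  shows "(\<Sum>d\<in>{y<..X}. f d) \<le> (\<Sum>k. f (k + Suc y))"
proof -
  have "(\<Sum>d\<in>{y<..X}. f d) \<le> (\<Sum>d\<in>(\<lambda>k. k + Suc y) ` {..<X}. f d)"
  proof (rule sum_mono2)
    show "{y<..X} \<subseteq> (\<lambda>k. k + Suc y) ` {..<X}"
    proof
      fix d assume "d \<in> {y<..X}"
      then show "d \<in> (\<lambda>k. k + Suc y) ` {..<X}" by (intro image_eqI[of _ _ "d - Suc y"]) auto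
    qed
  qed (use assms in auto)
  also have "\<dots> = (\<Sum>k<X. f (k + Suc y))" by (subst sum.reindex) (auto simp: inj_on_def)
  also have "\<dots> \<le> (\<Sum>k. f (k + Suc y))"
    using assms by (intro sum_le_suminf summable_ignore_initial_segment) auto
  finally show ?thesis .
qed

text \<open>The exponent \<open>-3/2\<close> comes from the bound \<open>1 / sqrt q\<close> for
  multiples of \<open>q\<close>, taken at \<open>q = d ^ 3\<close>; the sum runs over
  \<open>d > y\<close>.\<close>

definition tail :: "nat \<Rightarrow> real" where "tail y = (\<Sum>k. real (k + Suc y) powr (-3/2))"

lemma tail_tendsto_0: "tail \<longlonglongrightarrow> 0"
proof -
  have "summable (\<lambda>n. real n powr (-3/2))" by (subst summable_real_powr_iff) simp
  from suminf_exist_split2[OF this] have "(\<lambda>y. \<Sum>k. real (k + y) powr (-3/2)) \<longlonglongrightarrow> 0" .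
  then show ?thesis unfolding tail_def by (rule LIMSEQ_Suc)
qed

context palindrome_base
begin

section \<open>Palindromes up to \<open>x\<close>, sorted by length\<close>

abbreviation stars :: "real \<Rightarrow> nat set" where "stars x \<equiv> up_to (palindromes_star b) x"

text \<open>For \<open>x \<ge> 1\<close> this is the \<open>N\<close> with
  \<open>b ^ (2 * N) \<le> x < b ^ (2 * N + 2)\<close>, the largest \<open>K\<close> for which
  palindromes with \<open>2 * K + 1\<close> digits can be counted. The counts up to \<open>x\<close>
  have order \<open>b ^ N\<close>.\<close>

definition half_len :: "real \<Rightarrow> nat" where "half_len x = (LEAST N. x < real b ^ (2 * N + 2))"

lemma less_half_len: "x < real b ^ (2 * half_len x + 2)"
proof -
  obtain n where "x < real b ^ n" using real_arch_pow[of "real b" x] b2 by auto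
  also have "real b ^ n \<le> real b ^ (2 * n + 2)" using b2 by (intro power_increasing) auto
  finally show ?thesis unfolding half_len_def by (rule LeastI)
qed

lemma half_len_le:
  assumes "x \<ge> 1"
  shows "real b ^ (2 * half_len x) \<le> x"
proof (cases "half_len x")
  case (Suc k)
  then have "\<not> x < real b ^ (2 * k + 2)" unfolding half_len_def by (metis lessI not_less_Least)
  with Suc show ?thesis by simp
qed (use assms in simp)

lemma filterlim_half_len: "filterlim half_len at_top at_top"
  unfolding filterlim_at_top
proof
  fix M
  show "\<forall>\<^sub>F x in at_top. M \<le> half_len x"
    using eventually_ge_at_top[of "real b ^ (2 * M)"]
  proof eventually_elim
    case (elim x)
    then have "real b ^ (2 * M) < real b ^ (2 * half_len x + 2)" using less_half_len[of x] by linarith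
    then have "2 * M < 2 * half_len x + 2" by (rule power_less_imp_less_exp[rotated]) (use b2 in auto)
    then show ?case by simp
  qed
qed

text \<open>The leading digit equals the units digit, which is nonzero by coprimality to
  \<open>b\<close>. This separates the different lengths.\<close>

lemma padded_ge:
  assumes "n \<in> padded K" "coprime n (b ^ 3 - b)"
  shows "b ^ (2 * K) \<le> n"
proof (cases K)
  case 0
  have "n \<noteq> 0"
  proof
    assume "n = 0"
    with assms(2) have "b ^ 3 - b = 1" by simp
    with Suc_dvd_cube_diff b2 show False by simp
  qed
  with 0 show ?thesis by simp
next
  case (Suc L)
  from assms(1) obtain a r where ar: "n = a * (1 + b ^ (2 * Suc L)) + b * r" unfolding Suc by auto
  have "a \<noteq> 0"
  proof
    assume "a = 0"
    with ar have "b dvd n" by simp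
    with coprime_common_divisor_nat[OF assms(2), of b] b2 show False by (simp add: cube_diff_eq)
  qed
  then have "1 * (1 + b ^ (2 * Suc L)) \<le> a * (1 + b ^ (2 * Suc L))" by (intro mult_right_mono) auto
  also have "\<dots> \<le> n" unfolding ar by (rule le_add1)
  finally show ?thesis unfolding Suc by simp
qed

definition star_part :: "real \<Rightarrow> nat \<Rightarrow> nat set" where
  "star_part x K = {n \<in> padded K. coprime n (b ^ 3 - b) \<and> n \<le> nat \<lfloor>x\<rfloor>}"

lemma star_part_disjoint: "K \<noteq> K' \<Longrightarrow> star_part x K \<inter> star_part x K' = {}"
proof -
  have *: False if "K < K'" "n \<in> star_part x K" "n \<in> star_part x K'" for n K K'
  proof -
    have "n < b ^ (2 * K + 1)" using that padded_less by (auto simp: star_part_def)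
    also have "\<dots> \<le> b ^ (2 * K')" using that b2 by (intro power_increasing) auto
    also have "\<dots> \<le> n" using that padded_ge by (auto simp: star_part_def)
    finally show False by simp
  qed
  assume "K \<noteq> K'"
  then show ?thesis using *[of K K'] *[of K' K] by (cases "K < K'") auto
qed

lemma finite_star_part [simp]: "finite (star_part x K)"
  by (simp add: star_part_def)

lemma stars_eq:
  assumes "x \<ge> 1"
  shows "stars x = (\<Union>K\<le>half_len x. star_part x K)"
proof -
  have K: "K \<le> half_len x" if "n \<in> padded K" "coprime n (b ^ 3 - b)" "real n \<le> x" for n K
  proof -
    have "real b ^ (2 * K) \<le> real n" using padded_ge[OF that(1,2)] by (metis of_nat_le_iff of_nat_power)
    also have "\<dots> < real b ^ (2 * half_len x + 2)" using less_half_len[of x] that(3) by linarith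
    finally have "2 * K < 2 * half_len x + 2" by (rule power_less_imp_less_exp[rotated]) (use b2 in auto)
    then show ?thesis by simp
  qed
  have pos: "1 \<le> real n" if "n \<in> padded K" "coprime n (b ^ 3 - b)" for n K
  proof -
    have "1 \<le> b ^ (2 * K)" using b2 by simp
    then show ?thesis using padded_ge[OF that] by linarith
  qed
  have le: "real n \<le> x \<longleftrightarrow> n \<le> nat \<lfloor>x\<rfloor>" for n using assms by linarith
  show ?thesis
  proof (intro subset_antisym subsetI)
    fix n assume "n \<in> stars x"
    then obtain L where n: "n \<in> padded L" "coprime n (b ^ 3 - b)" "real n \<le> x"
      unfolding up_to_def palindromes_star_eq by blast
    then have "n \<in> star_part x L" using le by (simp add: star_part_def)
    with K[OF n] show "n \<in> (\<Union>K\<le>half_len x. star_part x K)" by blast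
  next
    fix n assume "n \<in> (\<Union>K\<le>half_len x. star_part x K)"
    then obtain L where n: "n \<in> padded L" "coprime n (b ^ 3 - b)" "n \<le> nat \<lfloor>x\<rfloor>"
      unfolding star_part_def by blast
    with pos[OF n(1,2)] le show "n \<in> stars x"
      unfolding up_to_def palindromes_star_eq by blast
  qed
qed

lemma finite_stars [simp]: "finite (stars x)"
  by (rule finite_subset[of _ "{..nat \<lfloor>x\<rfloor>}"]) (auto simp: up_to_def le_nat_floor)

lemma stars_disc:
  assumes q: "coprime q (b ^ 3 - b)" "q > 0"
  shows "\<exists>s. s \<longlonglongrightarrow> 0 \<and> (\<forall>x\<ge>1. disc q (stars x) \<le> real b ^ half_len x * s (half_len x))"
proof -
  from padded_disc[OF q] obtain \<rho> where \<rho>: "0 \<le> \<rho>" "\<rho> < 1" and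
    bd: "\<And>J L X. J > 0 \<Longrightarrow> disc q {n \<in> padded (J + L). coprime n (b ^ 3 - b) \<and> n \<le> X}
       \<le> real b ^ Suc (J + L) * (real (b\<^sup>2 - 1) * \<rho> ^ (L div 4) + 1 / real b ^ J)" by blast
  \<comment> \<open>The digits are halved: \<open>K - K div 2\<close> leading ones and
    \<open>K div 2\<close> middle ones. Both numbers tend to infinity, so the cutoff error and the
    exponential sum error vanish together.\<close>
  define e where "e = (\<lambda>K. real b * (real (b\<^sup>2 - 1) * \<rho> ^ (K div 2 div 4) + 1 / real b ^ (K - K div 2)))"
  have part: "disc q (star_part x K) \<le> real b ^ K * e K" for x K
  proof (cases "K = 0")
    \<comment> \<open>Length one has no leading digit to fix (\<open>J > 0\<close> fails), so the
      trivial bound is used.\<close>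
    case True
    have "card (star_part x 0) \<le> card (padded 0)" by (intro card_mono) (auto simp: star_part_def)
    then have "real (card (star_part x 0)) \<le> real b" by simp
    moreover have "real b \<le> e 0" unfolding e_def using b2 by simp
    ultimately show ?thesis using True disc_le_card[of "star_part x 0" q] q(2) by simp
  next
    case False
    then show ?thesis using bd[of "K - K div 2" "K div 2" "nat \<lfloor>x\<rfloor>"]
      by (simp add: e_def star_part_def mult_ac)
  qed
  have "e \<longlonglongrightarrow> real b * (real (b\<^sup>2 - 1) * 0 + 0)"
    unfolding e_def
  proof (intro tendsto_mult tendsto_add tendsto_const)
    have "filterlim (\<lambda>K::nat. K div 8) at_top at_top" by (rule filterlim_at_top_div_const_nat) simp
    moreover have "K div 8 = K div 2 div 4" for K :: nat by (simp add: div_mult2_eq[symmetric])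
    ultimately have "filterlim (\<lambda>K::nat. K div 2 div 4) at_top at_top" by simp
    from filterlim_compose[OF LIMSEQ_power_zero this, of \<rho>] show "(\<lambda>K. \<rho> ^ (K div 2 div 4)) \<longlonglongrightarrow> 0"
      using \<rho> by simp
    have "filterlim (\<lambda>K::nat. K div 2) at_top at_top" by (rule filterlim_at_top_div_const_nat) simp
    then have "filterlim (\<lambda>K::nat. K - K div 2) at_top at_top"
      by (rule filterlim_at_top_mono) (auto intro!: always_eventually)
    moreover have "norm (1 / real b) < 1" using b2 by simp
    ultimately have "(\<lambda>K. (1 / real b) ^ (K - K div 2)) \<longlonglongrightarrow> 0"
      by (intro filterlim_compose[OF LIMSEQ_power_zero])
    then show "(\<lambda>K. 1 / real b ^ (K - K div 2)) \<longlonglongrightarrow> 0"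
      by (simp only: power_one_over)
  qed
  then have e: "e \<longlonglongrightarrow> 0" by simp
  define s where "s = (\<lambda>N. (\<Sum>K\<le>N. real b ^ K * e K) / real b ^ N)"
  have "s \<longlonglongrightarrow> 0" unfolding s_def by (rule geometric_weighted_sum_tendsto_0[OF e]) (use b2 in simp)
  moreover have "disc q (stars x) \<le> real b ^ half_len x * s (half_len x)" if "x \<ge> 1" for x
  proof -
    have "disc q (stars x) \<le> (\<Sum>K\<le>half_len x. disc q (star_part x K))"
      unfolding stars_eq[OF that] by (rule disc_UN_le) (use star_part_disjoint in auto)
    also have "\<dots> \<le> (\<Sum>K\<le>half_len x. real b ^ K * e K)" by (intro sum_mono part)
    also have "\<dots> = real b ^ half_len x * s (half_len x)" unfolding s_def using b2 by simp
    finally show ?thesis .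
  qed
  ultimately show ?thesis by blast
qed

lemma card_stars_ge:
  "\<forall>\<^sub>F x in at_top. real b ^ half_len x \<le> real b ^ (2 * (b\<^sup>2 - 1) + 2) * real (card (stars x))"
  using eventually_ge_at_top[of 1] filterlim_half_len[unfolded filterlim_at_top, rule_format, of "2 * (b\<^sup>2 - 1) + 2"]
proof eventually_elim
  case (elim x)
  let ?M = "2 * (b\<^sup>2 - 1)"
  \<comment> \<open>Of the layers given up, \<open>?M\<close> serve to hit a residue modulo
    \<open>b^2 - 1\<close>, one is the outer digit 1, and one makes the palindromes short enough to
    lie below \<open>b ^ (2 * half_len x) \<le> x\<close>, so that no cutoff interferes.\<close>
  define J where "J = half_len x - (?M + 2)"
  have N: "half_len x = J + (?M + 2)" using elim(2) by (simp add: J_def)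
  have "b ^ J \<le> card {n \<in> padded (Suc (J + ?M)). coprime n (b ^ 3 - b)}" by (rule card_padded_coprime_ge)
  also have "\<dots> \<le> card (stars x)"
  proof (intro card_mono finite_stars subsetI)
    fix n assume n: "n \<in> {n \<in> padded (Suc (J + ?M)). coprime n (b ^ 3 - b)}"
    then have "n < b ^ (2 * Suc (J + ?M) + 1)" using padded_less by blast
    also have "\<dots> \<le> b ^ (2 * half_len x)" unfolding N using b2 by (intro power_increasing) auto
    finally have "real n \<le> real b ^ (2 * half_len x)" by (metis less_imp_le of_nat_le_iff of_nat_power)
    also have "\<dots> \<le> x" by (rule half_len_le[OF elim(1)])
    finally have "real n \<le> x" .
    moreover have "Suc (J + ?M) \<le> half_len x" unfolding N by simp
    moreover have "n \<in> star_part x (Suc (J + ?M))"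
      using n \<open>real n \<le> x\<close> unfolding star_part_def by (simp only: mem_Collect_eq le_nat_floor)
    ultimately show "n \<in> stars x" unfolding stars_eq[OF elim(1)] by blast
  qed
  finally have "real b ^ J \<le> real (card (stars x))" by (metis of_nat_le_iff of_nat_power)
  then have "real b ^ (?M + 2) * real b ^ J \<le> real b ^ (?M + 2) * real (card (stars x))"
    by (rule mult_left_mono) simp
  then show ?case unfolding N by (simp only: power_add mult_ac)
qed

section \<open>Limits: equidistribution, finite sieve and large cubes\<close>

lemma equidistribution_0:
  assumes q: "coprime q (b ^ 3 - b)" "q > 0"
  shows "((\<lambda>x. real (card {n \<in> stars x. q dvd n}) / real (card (stars x))) \<longlongrightarrow> 1 / real q) at_top"
proof -
  let ?A = "\<lambda>x. real (card {n \<in> stars x. q dvd n})" and ?c = "\<lambda>x. real (card (stars x))"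
  let ?C = "real b ^ (2 * (b\<^sup>2 - 1) + 2)"
  from stars_disc[OF q] obtain s where s: "s \<longlonglongrightarrow> 0"
    and le: "\<And>x. x \<ge> 1 \<Longrightarrow> disc q (stars x) \<le> real b ^ half_len x * s (half_len x)" by blast
  have lim: "((\<lambda>x. ?C * s (half_len x)) \<longlongrightarrow> ?C * 0) at_top"
    by (intro tendsto_mult tendsto_const filterlim_compose[OF s filterlim_half_len])
  have "((\<lambda>x. ?A x / ?c x - 1 / real q) \<longlongrightarrow> 0) at_top"
  proof (rule Lim_null_comparison)
    show "((\<lambda>x. ?C * s (half_len x)) \<longlongrightarrow> 0) at_top" using lim by simp
    show "\<forall>\<^sub>F x in at_top. norm (?A x / ?c x - 1 / real q) \<le> ?C * s (half_len x)"
      using card_stars_ge eventually_ge_at_top[of 1]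
    proof eventually_elim
      case (elim x)
      have bN: "0 < real b ^ half_len x" using b2 by simp
      have c0: "?c x > 0" using elim(1) bN by (cases "card (stars x) = 0") auto
      have s0: "0 \<le> s (half_len x)"
        using le[OF elim(2)] disc_nonneg[of q "stars x"] bN by (metis order_trans zero_le_mult_iff not_less)
      have "\<bar>?A x - ?c x / real q\<bar> \<le> real b ^ half_len x * s (half_len x)"
        using le[OF elim(2)] by (simp add: disc_def)
      also have "\<dots> \<le> (?C * ?c x) * s (half_len x)" by (rule mult_right_mono[OF elim(1) s0])
      finally have "\<bar>?A x - ?c x / real q\<bar> / ?c x \<le> ?C * s (half_len x)"
        using c0 by (simp add: divide_le_eq mult_ac)
      moreover have "?A x / ?c x - 1 / real q = (?A x - ?c x / real q) / ?c x"
      proof -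
        have "stars x \<noteq> {}" using c0 by auto
        then show ?thesis by (simp add: diff_divide_distrib)
      qed
      ultimately show ?case using c0 by (simp add: abs_divide)
    qed
  qed
  then show ?thesis by (simp add: LIM_zero_iff)
qed

text \<open>The extra condition \<open>e ^ 3 dvd n\<close> makes the induction close: numbers not
  divisible by \<open>p ^ 3\<close> are counted as those for \<open>e\<close> minus those for
  \<open>e * p\<close>, and both counts fall under the induction hypothesis.\<close>

lemma sieved_density:
  assumes "finite S" "\<And>p. p \<in> S \<Longrightarrow> prime p" "\<And>p. p \<in> S \<Longrightarrow> coprime p (b ^ 3 - b)"
    "\<And>p. p \<in> S \<Longrightarrow> coprime p e" "coprime e (b ^ 3 - b)" "e > 0"
  shows "((\<lambda>x. real (card {n \<in> stars x. e ^ 3 dvd n \<and> (\<forall>p\<in>S. \<not> p ^ 3 dvd n)}) / real (card (stars x)))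
    \<longlongrightarrow> 1 / real e ^ 3 * (\<Prod>p\<in>S. 1 - 1 / real p ^ 3)) at_top"
  using assms
proof (induction S arbitrary: e rule: finite_induct)
  case empty
  then show ?case using equidistribution_0[of "e ^ 3"] by simp
next
  case (insert p S)
  let ?A = "\<lambda>e x. {n \<in> stars x. e ^ 3 dvd n \<and> (\<forall>p\<in>S. \<not> p ^ 3 dvd n)}"
  let ?P = "\<Prod>p\<in>S. 1 - 1 / real p ^ 3"
  have p: "prime p" "coprime p (b ^ 3 - b)" "coprime p e" using insert.prems by auto
  have 1: "((\<lambda>x. real (card (?A e x)) / real (card (stars x))) \<longlongrightarrow> 1 / real e ^ 3 * ?P) at_top"
    using insert.prems by (intro insert.IH) auto
  have 2: "((\<lambda>x. real (card (?A (e * p) x)) / real (card (stars x))) \<longlongrightarrow> 1 / real (e * p) ^ 3 * ?P) at_top"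
  proof (rule insert.IH)
    show "coprime r (e * p)" if "r \<in> S" for r
      using that insert.prems insert.hyps(2) by (auto intro: primes_coprime)
  qed (use insert.prems p prime_gt_0_nat in auto)
  have "real (card {n \<in> stars x. e ^ 3 dvd n \<and> (\<forall>p\<in>insert p S. \<not> p ^ 3 dvd n)})
     = real (card (?A e x)) - real (card (?A (e * p) x))" for x
  proof -
    have "coprime (e ^ 3) (p ^ 3)" using p(3) by (simp add: coprime_commute)
    then have dv: "(e * p) ^ 3 dvd n \<longleftrightarrow> e ^ 3 dvd n \<and> p ^ 3 dvd n" for n
      unfolding power_mult_distrib by (meson divides_mult dvd_mult_left dvd_mult_right)
    have "{n \<in> stars x. e ^ 3 dvd n \<and> (\<forall>p\<in>insert p S. \<not> p ^ 3 dvd n)} = ?A e x - ?A (e * p) x"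
      using dv by auto
    moreover have "?A (e * p) x \<subseteq> ?A e x" using dv by auto
    moreover have "card (?A (e * p) x) \<le> card (?A e x)" using dv by (intro card_mono) auto
    ultimately show ?thesis by (simp add: card_Diff_subset)
  qed
  then have "(\<lambda>x. real (card {n \<in> stars x. e ^ 3 dvd n \<and> (\<forall>p\<in>insert p S. \<not> p ^ 3 dvd n)}) / real (card (stars x)))
    = (\<lambda>x. real (card (?A e x)) / real (card (stars x)) - real (card (?A (e * p) x)) / real (card (stars x)))"
    by (simp add: diff_divide_distrib)
  moreover have "1 / real e ^ 3 * (\<Prod>p\<in>insert p S. 1 - 1 / real p ^ 3)
     = 1 / real e ^ 3 * ?P - 1 / real (e * p) ^ 3 * ?P"
    using insert.hyps by (simp add: power_mult_distrib algebra_simps)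
  ultimately show ?case using tendsto_diff[OF 1 2] by (simp only:)
qed

text \<open>Union bound over lengths and over \<open>d\<close>, where \<open>d\<close> inherits
  coprimality to \<open>b\<close> from \<open>n\<close>. The sum over lengths is geometric and costs
  a factor 2, and the sum over \<open>d\<close> is at most \<open>tail y\<close>.\<close>

lemma card_large_cube_le:
  assumes "x \<ge> 1"
  shows "real (card {n \<in> stars x. \<exists>d>y. d ^ 3 dvd n})
    \<le> 2 * real b ^ 2 * sqrt (real b) * tail y * real b ^ half_len x"
proof -
  let ?N = "half_len x" and ?X = "nat \<lfloor>x\<rfloor>"
  let ?D = "{d \<in> {y<..?X}. coprime d b}"
  let ?T = "\<lambda>K d. {n \<in> padded K. n > 0 \<and> d ^ 3 dvd n}"
  have "{n \<in> stars x. \<exists>d>y. d ^ 3 dvd n} \<subseteq> (\<Union>K\<le>?N. \<Union>d\<in>?D. ?T K d)"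
  proof
    fix n assume "n \<in> {n \<in> stars x. \<exists>d>y. d ^ 3 dvd n}"
    then obtain d where "n \<in> stars x" and d: "d > y" "d ^ 3 dvd n" by blast
    then obtain K where K: "K \<le> ?N" "n \<in> star_part x K" unfolding stars_eq[OF assms] by blast
    have n0: "n > 0" using \<open>n \<in> stars x\<close> by (simp add: up_to_def)
    have n: "n \<in> padded K" "coprime n (b ^ 3 - b)" "n \<le> ?X" using K(2) by (auto simp: star_part_def)
    have "d dvd n" using dvd_trans[OF dvd_power d(2)] by simp
    then have "d \<le> ?X" using dvd_imp_le[OF _ n0] n(3) le_trans by blast
    moreover have "coprime d b"
    proof -
      have "coprime n b" using n(2) by (simp add: cube_diff_eq)
      with \<open>d dvd n\<close> show ?thesis using coprime_divisors[of d n b b] by simp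
    qed
    ultimately have "d \<in> ?D" using d(1) by simp
    moreover have "n \<in> ?T K d" using n(1) n0 d(2) by simp
    ultimately show "n \<in> (\<Union>K\<le>?N. \<Union>d\<in>?D. ?T K d)" using K(1) by (intro UN_I[of K] UN_I[of d]) auto
  qed
  then have "card {n \<in> stars x. \<exists>d>y. d ^ 3 dvd n} \<le> card (\<Union>K\<le>?N. \<Union>d\<in>?D. ?T K d)"
    by (intro card_mono) auto
  also have "\<dots> \<le> (\<Sum>K\<le>?N. \<Sum>d\<in>?D. card (?T K d))"
    by (intro order.trans[OF card_UN_le] sum_mono card_UN_le) auto
  finally have "real (card {n \<in> stars x. \<exists>d>y. d ^ 3 dvd n}) \<le> (\<Sum>K\<le>?N. \<Sum>d\<in>?D. real (card (?T K d)))"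
    by (simp flip: of_nat_sum)
  also have "\<dots> \<le> (\<Sum>K\<le>?N. \<Sum>d\<in>?D. real b ^ 2 * sqrt (real b) * real b ^ K * real d powr (-3/2))"
  proof (intro sum_mono)
    fix K d assume d: "d \<in> ?D"
    then have d0: "d > 0" by auto
    have "real (card (?T K d)) \<le> real b ^ 2 * sqrt (real b ^ (2 * K + 1) / real (d ^ 3))"
      by (rule card_padded_multiples_le) (use d d0 in auto)
    also have "sqrt (real b ^ (2 * K + 1) / real (d ^ 3)) = sqrt (real b) * real b ^ K * real d powr (-3/2)"
    proof (rule real_sqrt_unique)
      have "(real d powr (-3/2))\<^sup>2 = real d powr (-3)"
        using d0 by (simp add: powr_power)
      also have "\<dots> = 1 / real d ^ 3" using d0 by (simp add: powr_minus divide_inverse powr_numeral)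
      finally show "(sqrt (real b) * real b ^ K * real d powr (-3/2))\<^sup>2 = real b ^ (2 * K + 1) / real (d ^ 3)"
        by (simp add: power_mult_distrib power_mult[symmetric] mult.commute)
    qed simp
    finally show "real (card (?T K d)) \<le> real b ^ 2 * sqrt (real b) * real b ^ K * real d powr (-3/2)"
      by (simp add: mult_ac)
  qed
  also have "\<dots> = real b ^ 2 * sqrt (real b) * (\<Sum>K\<le>?N. real b ^ K) * (\<Sum>d\<in>?D. real d powr (-3/2))"
    by (subst mult.assoc, subst sum_product) (simp only: sum_distrib_left mult.assoc)
  also have "\<dots> \<le> real b ^ 2 * sqrt (real b) * (2 * real b ^ ?N) * tail y"
  proof (intro mult_mono)
    have "(\<Sum>d\<in>?D. real d powr (-3/2)) \<le> (\<Sum>d\<in>{y<..?X}. real d powr (-3/2))"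
      by (intro sum_mono2) auto
    also have "\<dots> \<le> tail y" unfolding tail_def
      by (rule sum_tail_le_suminf) (simp_all add: summable_real_powr_iff)
    finally show "(\<Sum>d\<in>?D. real d powr (-3/2)) \<le> tail y" .
    show "(\<Sum>K\<le>?N. real b ^ K) \<le> 2 * real b ^ ?N" by (rule sum_power_le) (use b2 in simp)
  qed (auto intro!: sum_nonneg)
  finally show ?thesis by (simp add: mult_ac)
qed

text \<open>For fixed \<open>y\<close>, the cubefree count and the count sieved by primes up to
  \<open>y\<close> differ only by numbers divisible by some \<open>d ^ 3\<close> with
  \<open>d > y\<close>. The relative error is at most \<open>C * tail y\<close> for all large
  \<open>x\<close>, so letting \<open>x\<close> and then \<open>y\<close> tend to infinity gives the
  limit.\<close>

lemma cubefree_density: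
  "((\<lambda>x. real (card {n \<in> stars x. cubefree n}) / real (card (stars x))) \<longlongrightarrow>
    1 / riemann_zeta 3 * (\<Prod>p | prime p \<and> p dvd b ^ 3 - b. inverse (1 - 1 / real p ^ 3))) at_top"
    (is "(?F \<longlongrightarrow> ?\<kappa>) at_top")
proof -
  define B where "B = b ^ 3 - b"
  have B0: "B > 0" unfolding B_def cube_diff_eq using b2 square_diff_pos by simp
  define S where "S = (\<lambda>y. {p. prime p \<and> p \<le> y \<and> \<not> p dvd B})"
  define \<kappa> where "\<kappa> = (\<lambda>y. \<Prod>p\<in>S y. 1 - 1 / real p ^ 3)"
  define G where "G = (\<lambda>y x. real (card {n \<in> stars x. \<forall>p\<in>S y. \<not> p ^ 3 dvd n}) / real (card (stars x)))"
  define C where "C = 2 * real b ^ 2 * sqrt (real b) * real b ^ (2 * (b\<^sup>2 - 1) + 2)"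
  have \<kappa>: "\<kappa> \<longlonglongrightarrow> ?\<kappa>"
    unfolding \<kappa>_def S_def using euler_product_3_coprime[OF B0] by (simp add: B_def)
  have G: "(G y \<longlongrightarrow> \<kappa> y) at_top" for y
  proof -
    have "finite (S y)" unfolding S_def by (rule finite_subset[of _ "{..y}"]) auto
    then have "((\<lambda>x. real (card {n \<in> stars x. 1 ^ 3 dvd n \<and> (\<forall>p\<in>S y. \<not> p ^ 3 dvd n)}) / real (card (stars x)))
      \<longlongrightarrow> 1 / real 1 ^ 3 * (\<Prod>p\<in>S y. 1 - 1 / real p ^ 3)) at_top"
    proof (rule sieved_density)
      show "coprime p (b ^ 3 - b)" if "p \<in> S y" for p
        using that prime_imp_coprime[of p B] by (simp add: S_def B_def)
    qed (simp_all add: S_def)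
    then show ?thesis by (simp add: G_def \<kappa>_def)
  qed
  have diff: "\<forall>\<^sub>F x in at_top. \<bar>?F x - G y x\<bar> \<le> C * tail y" for y
    using card_stars_ge eventually_ge_at_top[of 1]
  proof eventually_elim
    case (elim x)
    let ?f = "{n \<in> stars x. cubefree n}" and ?g = "{n \<in> stars x. \<forall>p\<in>S y. \<not> p ^ 3 dvd n}"
      and ?h = "{n \<in> stars x. \<exists>d>y. d ^ 3 dvd n}"
    have sub: "?f \<subseteq> ?g" by (auto simp: cubefree_iff_prime S_def)
    have "?g \<subseteq> ?f \<union> ?h"
    proof
      fix n assume n: "n \<in> ?g"
      have "cubefree n" if "\<not> (\<exists>d>y. d ^ 3 dvd n)"
        unfolding cubefree_iff_prime
      proof (intro allI impI notI)
        fix p assume p: "prime p" "p ^ 3 dvd n"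
        \<comment> \<open>Primes dividing \<open>B\<close> never divide \<open>n\<close>, so
          \<open>S y\<close> may omit them; their absence from the Euler product produces the
          correction factor in the limit.\<close>
        have "coprime n B" using n by (auto simp: up_to_def palindromes_star_def B_def)
        moreover have "p dvd n" using dvd_trans[OF dvd_power p(2)] by simp
        ultimately have "\<not> p dvd B" using p(1) coprime_common_divisor_nat[of n B p] by auto
        with p that have "p \<in> S y" by (auto simp: S_def not_less)
        with n p show False by auto
      qed
      with n show "n \<in> ?f \<union> ?h" by auto
    qed
    then have "card ?g \<le> card ?f + card ?h"
      by (intro order.trans[OF card_mono card_Un_le]) auto
    moreover have "card ?f \<le> card ?g" using sub by (intro card_mono) auto
    ultimately have "\<bar>real (card ?f) - real (card ?g)\<bar> \<le> real (card ?h)" by linarith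
    also have "\<dots> \<le> 2 * real b ^ 2 * sqrt (real b) * tail y * real b ^ half_len x"
      by (rule card_large_cube_le[OF elim(2)])
    also have "\<dots> \<le> 2 * real b ^ 2 * sqrt (real b) * tail y * (real b ^ (2 * (b\<^sup>2 - 1) + 2) * real (card (stars x)))"
    proof (intro mult_left_mono[OF elim(1)] mult_nonneg_nonneg)
      show "0 \<le> tail y" unfolding tail_def
        by (intro suminf_nonneg summable_ignore_initial_segment) (simp_all add: summable_real_powr_iff)
    qed auto
    finally have le: "\<bar>real (card ?f) - real (card ?g)\<bar> \<le> C * tail y * real (card (stars x))"
      by (simp add: C_def mult_ac)
    have "0 < real b ^ half_len x" using b2 by simp
    have "card (stars x) \<noteq> 0"
    proof
      assume "card (stars x) = 0"
      with elim(1) have "real b ^ half_len x \<le> 0" by (simp only: of_nat_0 mult_zero_right)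
      with \<open>0 < real b ^ half_len x\<close> show False by linarith
    qed
    then have c0: "real (card (stars x)) > 0" by linarith
    have "?F x - G y x = (real (card ?f) - real (card ?g)) / real (card (stars x))"
      by (simp add: G_def diff_divide_distrib)
    then show ?case using le c0 by (simp add: abs_divide divide_le_eq)
  qed
  show ?thesis
  proof (rule tendstoI)
    fix r :: real assume r: "0 < r"
    have "(\<lambda>y. C * tail y) \<longlonglongrightarrow> C * 0" by (intro tendsto_mult tendsto_const tail_tendsto_0)
    then have "\<forall>\<^sub>F y in sequentially. dist (C * tail y) 0 < r / 3" using r by (intro tendstoD) auto
    moreover have "\<forall>\<^sub>F y in sequentially. dist (\<kappa> y) ?\<kappa> < r / 3" using r by (intro tendstoD[OF \<kappa>]) auto
    ultimately have "\<forall>\<^sub>F y in sequentially. dist (C * tail y) 0 < r / 3 \<and> dist (\<kappa> y) ?\<kappa> < r / 3"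
      by (rule eventually_conj)
    then obtain y where "dist (C * tail y) 0 < r / 3" "dist (\<kappa> y) ?\<kappa> < r / 3"
      by (auto dest!: eventually_happens)
    then have y: "C * tail y < r / 3" "\<bar>\<kappa> y - ?\<kappa>\<bar> < r / 3"
      unfolding dist_real_def by linarith+
    \<comment> \<open>With \<open>y\<close> now fixed, three errors below \<open>r / 3\<close> add
      up: large cubes, finite sieve density, truncated Euler product.\<close>
    have "\<forall>\<^sub>F x in at_top. dist (G y x) (\<kappa> y) < r / 3" using r by (intro tendstoD[OF G]) auto
    with diff[of y] show "\<forall>\<^sub>F x in at_top. dist (?F x) ?\<kappa> < r"
    proof eventually_elim
      case (elim x)
      then show ?case using y unfolding dist_real_def by linarith
    qed
  qed
qed

lemma card_stars_at_top: "filterlim (\<lambda>x. real (card (stars x))) at_top at_top"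
proof (rule filterlim_at_top_mono)
  let ?C = "real b ^ (2 * (b\<^sup>2 - 1) + 2)"
  have C: "?C > 0" using b2 by simp
  have "filterlim (\<lambda>x. real b ^ half_len x) at_top at_top"
  proof (rule filterlim_at_top_mono)
    show "filterlim (\<lambda>x. real (half_len x)) at_top at_top"
      by (rule filterlim_compose[OF filterlim_real_sequentially filterlim_half_len])
    have "real N \<le> real b ^ N" for N
    proof -
      have "N < b ^ N" using b2 by (intro power_gt_expt) simp
      then have "real N \<le> real (b ^ N)" by (simp only: of_nat_le_iff less_imp_le)
      then show ?thesis by (simp only: of_nat_power)
    qed
    then show "\<forall>\<^sub>F x in at_top. real (half_len x) \<le> real b ^ half_len x" by (intro always_eventually) auto
  qed
  then show "filterlim (\<lambda>x. 1 / ?C * real b ^ half_len x) at_top at_top"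
    by (intro filterlim_tendsto_pos_mult_at_top[OF tendsto_const]) (use C in auto)
  show "\<forall>\<^sub>F x in at_top. 1 / ?C * real b ^ half_len x \<le> real (card (stars x))"
    using card_stars_ge
  proof eventually_elim
    case (elim x)
    then show ?case using C by (simp add: divide_le_eq mult.commute)
  qed
qed

end

theorem theorem1p3:
  fixes b :: nat
  assumes "b \<ge> 1100"
  shows "infinite {n \<in> palindromes_star b. cubefree n} \<and>
    (\<lambda>x::real. \<Sum>n | n \<in> up_to (palindromes_star b) x \<and> cubefree n. 1 :: real)
      \<sim>[at_top]
    (\<lambda>x. real (card (up_to (palindromes_star b) x)) / riemann_zeta 3 *
      (\<Prod>p | prime p \<and> p dvd b ^ 3 - b. inverse (1 - 1 / real p ^ 3)))"
proof -
  interpret palindrome_base b by unfold_locales (use assms in simp)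
  let ?\<kappa> = "1 / riemann_zeta 3 * (\<Prod>p | prime p \<and> p dvd b ^ 3 - b. inverse (1 - 1 / real p ^ 3))"
  have \<kappa>: "?\<kappa> > 0"
    using riemann_zeta_3_pos one_minus_inverse_cube_pos by (intro mult_pos_pos prod_pos) auto
  have k0: "?\<kappa> \<noteq> 0" using less_imp_neq[OF \<kappa>] by (rule not_sym)
  let ?f = "\<lambda>x. real (card {n \<in> stars x. cubefree n})" and ?c = "\<lambda>x. real (card (stars x))"
  have "infinite {n \<in> palindromes_star b. cubefree n}"
  proof
    assume fin: "finite {n \<in> palindromes_star b. cubefree n}"
    \<comment> \<open>A finite set has relative density 0, because the number of palindromes in
      \<open>stars x\<close> tends to infinity; this contradicts the positive limit.\<close>
    have "((\<lambda>x. ?f x / ?c x) \<longlongrightarrow> 0) at_top"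
    proof (rule Lim_null_comparison)
      show "((\<lambda>x. real (card {n \<in> palindromes_star b. cubefree n}) / ?c x) \<longlongrightarrow> 0) at_top"
        by (rule real_tendsto_divide_at_top[OF tendsto_const card_stars_at_top])
      have "?f x \<le> real (card {n \<in> palindromes_star b. cubefree n})" for x
        by (simp, rule card_mono[OF fin]) (auto simp: up_to_def)
      then show "\<forall>\<^sub>F x in at_top. norm (?f x / ?c x) \<le> real (card {n \<in> palindromes_star b. cubefree n}) / ?c x"
        by (intro always_eventually) (simp add: divide_right_mono)
    qed
    have "?\<kappa> = 0" by (rule tendsto_unique[OF _ cubefree_density \<open>((\<lambda>x. ?f x / ?c x) \<longlongrightarrow> 0) at_top\<close>]) simp
    with \<kappa> show False by (simp only: less_irrefl)
  qed
  moreover have "?f \<sim>[at_top] (\<lambda>x. ?c x * ?\<kappa>)"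
  proof (rule asymp_equivI')
    have "((\<lambda>x. (?f x / ?c x) / ?\<kappa>) \<longlongrightarrow> ?\<kappa> / ?\<kappa>) at_top"
      by (intro tendsto_divide cubefree_density tendsto_const k0)
    then show "((\<lambda>x. ?f x / (?c x * ?\<kappa>)) \<longlongrightarrow> 1) at_top"
      by (simp only: divide_divide_eq_left divide_self[OF k0])
  qed
  ultimately show ?thesis by simp
qed

end
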